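(* For integers $s,t\ge 2$, \[ R^3(BK_s, BK_t) = \begin{cases} t+s-1 & \text{if } s=t=2,\ s=t=3,\ \{s,t\}=\{2,3\} \text{ or } \{s,t\}=\{2,4\},\\ t+s-2 & \text{if } s=2,\ t\ge 5, \text{ or } s=3,\ t\ge 4, \text{ or } s=t=4,\\ t+s-3 & \text{if } s\ge 4 \text{ and } t\ge 5. \end{cases} \]
   Context: For a graph $G=(V,E)$ and an integer $r\ge 2$, $BG$ (the set of Berge copies of $G$) is the set of $r$-uniform hypergraphs $\mathcal{H}'$ for which there exist an injection $\phi: V\to V(\mathcal{H}')$ and a bijection $\psi: E\to E(\mathcal{H}')$ such that $\{\phi(u),\phi(v)\}\subseteq \psi(uv)$ for every edge $uv\in E$. $K_n$ denotes the complete graph on $n$ vertices. For collections $\mathcal{F}_1,\mathcal{F}_2$ of $r$-uniform hypergraphs, the Ramsey number $R^r(\mathcal{F}_1,\mathcal{F}_2)$ is the least $N$ such that in every coloring of the hyperedges of the complete $r$-uniform hypergraph on $N$ vertices with two colors (first and second color), there is a subhypergraph all of whose hyperedges have the first color and which is isomorphic to a member of $\mathcal{F}_1$, or one all of whose hyperedges have the second color and which is isomorphic to a member of $\mathcal{F}_2$. Here $r=3$. *)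

theory Defs
  imports "HOL-Library.Ramsey"
begin

datatype 'a hypergraph = Hypergraph (hverts: "'a set") (hedges: "'a set set")

text \<open>
  The notation \<open>[A]\<^bsup>k\<^esup>\<close> (\<^const>\<open>nsets\<close>) is the set of finite \<open>k\<close>-element subsets of \<open>A\<close>.
  A finite simple graph is the case \<open>r = 2\<close>.
\<close>

definition uniform_hypergraph :: "nat \<Rightarrow> 'a hypergraph \<Rightarrow> bool" where
  "uniform_hypergraph r H \<longleftrightarrow> finite (hverts H) \<and> hedges H \<subseteq> [hverts H]\<^bsup>r\<^esup>"

definition complete_hypergraph :: "nat \<Rightarrow> nat \<Rightarrow> nat hypergraph" where
  "complete_hypergraph r n = Hypergraph {..<n} ([{..<n}]\<^bsup>r\<^esup>)"

definition complete_graph :: "nat \<Rightarrow> nat hypergraph" where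
  "complete_graph n = complete_hypergraph 2 n"

definition subhypergraph :: "'a hypergraph \<Rightarrow> 'a hypergraph \<Rightarrow> bool" where
  "subhypergraph H' H \<longleftrightarrow>
     hverts H' \<subseteq> hverts H \<and> hedges H' \<subseteq> hedges H \<and> hedges H' \<subseteq> Pow (hverts H')"

definition hypergraph_iso :: "'a hypergraph \<Rightarrow> 'b hypergraph \<Rightarrow> bool" where
  "hypergraph_iso H H' \<longleftrightarrow>
     (\<exists>f. bij_betw f (hverts H) (hverts H') \<and> bij_betw ((`) f) (hedges H) (hedges H'))"

text \<open>
  Every finite hypergraph is isomorphic to one with vertices in \<^typ>\<open>nat\<close>, and the collections
  below are used only up to isomorphism, so the vertex type \<^typ>\<open>nat\<close> loses no generality.
\<close>

definition berge_copies :: "nat \<Rightarrow> 'v hypergraph \<Rightarrow> nat hypergraph set" where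
  "berge_copies r G =
     {H. uniform_hypergraph r H \<and>
         (\<exists>\<phi> \<psi>. inj_on \<phi> (hverts G) \<and> \<phi> ` hverts G \<subseteq> hverts H \<and>
                bij_betw \<psi> (hedges G) (hedges H) \<and>
                (\<forall>u v. {u, v} \<in> hedges G \<longrightarrow> {\<phi> u, \<phi> v} \<subseteq> \<psi> {u, v}))}"

datatype colour = First | Second

definition monochromatic_copy ::
  "('a set \<Rightarrow> colour) \<Rightarrow> colour \<Rightarrow> 'a hypergraph \<Rightarrow> nat hypergraph set \<Rightarrow> bool" where
  "monochromatic_copy c i H \<F> \<longleftrightarrow>
     (\<exists>H'. subhypergraph H' H \<and> (\<forall>e \<in> hedges H'. c e = i) \<and> (\<exists>F \<in> \<F>. hypergraph_iso H' F))"

text \<open>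
  A colouring is a total function on vertex sets; only its values on hyperedges matter.
  As usual for \<open>LEAST\<close>, the Ramsey number is an unspecified value if no such \<open>N\<close> exists.
\<close>

definition ramsey_number :: "nat \<Rightarrow> nat hypergraph set \<Rightarrow> nat hypergraph set \<Rightarrow> nat" where
  "ramsey_number r \<F>1 \<F>2 =
     (LEAST N. \<forall>c :: nat set \<Rightarrow> colour.
        monochromatic_copy c First (complete_hypergraph r N) \<F>1 \<or>
        monochromatic_copy c Second (complete_hypergraph r N) \<F>2)"

end

theory Submission
  imports Defs
begin

text \<open>
  Fix a vertex \<open>x\<close>. The hyperedges through \<open>x\<close> of either colour form a graph on the remaining
  vertices, its link, and the two links are complementary, so one of them is connected. If the link
  of colour \<open>i\<close> is connected, then every Berge clique of colour \<open>i\<close> that avoids \<open>x\<close> and at least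
  one further vertex \<open>r\<close> extends by \<open>x\<close>: root a spanning tree of the link at \<open>r\<close> and cover \<open>xa\<close> by
  \<open>x\<close> together with the edge from \<open>a\<close> to its parent. Hence \<open>(s, t)\<close> follows from \<open>(s - 1, t)\<close> and
  \<open>(s, t - 1)\<close> on one vertex less. For \<open>s = 4\<close> the pair \<open>(3, t)\<close> is not available; there one may
  assume that every link of the second colour is disconnected, which yields a Berge triangle of the
  first colour directly. The remaining finite cases, \<open>(3, 4)\<close> on five and \<open>(4, 5)\<close> on six
  vertices, are settled by decision trees that were found by computer search.

  For the main lower bound split the \<open>s + t - 4\<close> vertices into parts of sizes \<open>s - 2\<close> and \<open>t - 2\<close> and
  colour a hyperedge by the part in which it has at least two vertices.
\<close>

section \<open>Berge cliques\<close>

text \<open>A Berge clique is reduced to its core \<open>S\<close> and an injective choice of a host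
  hyperedge \<open>f p\<close> for each pair \<open>p\<close>; a host may leave the core but not
  \<open>V\<close>. Which \<open>V\<close> the hosts live in matters later: a clique inside
  \<open>V - {x}\<close> has only hosts that avoid \<open>x\<close>.\<close>

definition berge_clique :: "('a set \<Rightarrow> colour) \<Rightarrow> colour \<Rightarrow> 'a set \<Rightarrow> 'a set \<Rightarrow> bool" where
  "berge_clique c i V S \<longleftrightarrow> S \<subseteq> V \<and>
     (\<exists>f. inj_on f ([S]\<^bsup>2\<^esup>) \<and> (\<forall>p \<in> [S]\<^bsup>2\<^esup>. p \<subseteq> f p \<and> f p \<in> [V]\<^bsup>3\<^esup> \<and> c (f p) = i))"

definition has_clique :: "('a set \<Rightarrow> colour) \<Rightarrow> colour \<Rightarrow> 'a set \<Rightarrow> nat \<Rightarrow> bool" where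
  "has_clique c i V k \<longleftrightarrow> (\<exists>S. finite S \<and> card S = k \<and> berge_clique c i V S)"

lemma has_clique_mono:
  assumes "has_clique c i V k" "V \<subseteq> V'" "k' \<le> k"
  shows "has_clique c i V' k'"
proof -
  obtain S f where S: "finite S" "card S = k" "S \<subseteq> V" "inj_on f ([S]\<^bsup>2\<^esup>)"
    "\<forall>p \<in> [S]\<^bsup>2\<^esup>. p \<subseteq> f p \<and> f p \<in> [V]\<^bsup>3\<^esup> \<and> c (f p) = i"
    using assms(1) unfolding has_clique_def berge_clique_def by blast
  obtain S' where S': "S' \<subseteq> S" "card S' = k'" "finite S'"
    using obtain_subset_with_card_n[of k' S] S assms(3) by auto
  have sub: "[S']\<^bsup>2\<^esup> \<subseteq> [S]\<^bsup>2\<^esup>" "[V]\<^bsup>3\<^esup> \<subseteq> [V']\<^bsup>3\<^esup>"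
    using S' assms(2) by (simp_all add: nsets_mono)
  have "inj_on f ([S']\<^bsup>2\<^esup>)" using S(4) sub(1) by (rule inj_on_subset)
  moreover have "\<forall>p \<in> [S']\<^bsup>2\<^esup>. p \<subseteq> f p \<and> f p \<in> [V']\<^bsup>3\<^esup> \<and> c (f p) = i"
    using S(5) sub by blast
  ultimately have "berge_clique c i V' S'"
    unfolding berge_clique_def using S' S(3) assms(2) by blast
  then show ?thesis unfolding has_clique_def using S' by blast
qed

text \<open>Colouring and colour change together, which serves the exchange of the two colours in
  \<open>arrows_commute\<close>.\<close>

lemma has_clique_cong:
  assumes "\<And>e. c' e = i' \<longleftrightarrow> c e = i"
  shows "has_clique c' i' V k \<longleftrightarrow> has_clique c i V k"
  unfolding has_clique_def berge_clique_def assms ..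

section \<open>Relabelling the vertices\<close>

lemma nsets_image_iff:
  assumes "inj_on h V" "e \<subseteq> V"
  shows "h ` e \<in> [h ` V]\<^bsup>k\<^esup> \<longleftrightarrow> e \<in> [V]\<^bsup>k\<^esup>"
proof -
  have "inj_on h e" using assms inj_on_subset by blast
  then show ?thesis using assms(2) unfolding nsets_def
    by (auto simp: card_image finite_image_iff)
qed

text \<open>Pulling the colouring back along \<open>h\<close> makes results about
  \<open>{..<n}\<close> available on every set of \<open>n\<close> vertices and allows normal forms
  in the finite searches.\<close>

lemma has_clique_image:
  assumes h: "inj_on h V" and "has_clique (\<lambda>e. c (h ` e)) i V k"
  shows "has_clique c i (h ` V) k"
proof -
  obtain S f where S: "finite S" "card S = k" "S \<subseteq> V" "inj_on f ([S]\<^bsup>2\<^esup>)"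
    "\<forall>p \<in> [S]\<^bsup>2\<^esup>. p \<subseteq> f p \<and> f p \<in> [V]\<^bsup>3\<^esup> \<and> c (h ` f p) = i"
    using assms(2) unfolding has_clique_def berge_clique_def by blast
  have hS: "inj_on h S" using h S(3) inj_on_subset by blast
  \<comment> \<open>Take a pair back to \<open>S\<close>, choose its host there, and push that host
    forward by \<open>h\<close>.\<close>
  define f' where "f' = (\<lambda>p. h ` f (inv_into S h ` p))"
  have q: "inv_into S h ` p \<in> [S]\<^bsup>2\<^esup> \<and> h ` (inv_into S h ` p) = p" if "p \<in> [h ` S]\<^bsup>2\<^esup>" for p
  proof -
    have p: "p \<subseteq> h ` S" using that by (auto simp: nsets_def)
    then have "h ` (inv_into S h ` p) = p" by (simp add: image_inv_into_cancel)
    moreover have "inv_into S h ` p \<subseteq> S" using p by (auto intro: inv_into_into)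
    ultimately show ?thesis using nsets_image_iff[OF hS, of "inv_into S h ` p" 2] that by simp
  qed
  have fV: "f p \<subseteq> V" if "p \<in> [S]\<^bsup>2\<^esup>" for p using S(5) that by (auto simp: nsets_def)
  have "inj_on f' ([h ` S]\<^bsup>2\<^esup>)"
  proof (rule inj_onI)
    fix p p' assume p: "p \<in> [h ` S]\<^bsup>2\<^esup>" "p' \<in> [h ` S]\<^bsup>2\<^esup>" "f' p = f' p'"
    have "f (inv_into S h ` p) = f (inv_into S h ` p')"
      using p(3) unfolding f'_def
      by (subst (asm) inj_on_image_eq_iff[OF h]) (use fV q[OF p(1)] q[OF p(2)] in auto)
    then have "inv_into S h ` p = inv_into S h ` p'" using S(4) q p by (meson inj_onD)
    then show "p = p'" using q p by metis
  qed
  moreover have "\<forall>p \<in> [h ` S]\<^bsup>2\<^esup>. p \<subseteq> f' p \<and> f' p \<in> [h ` V]\<^bsup>3\<^esup> \<and> c (f' p) = i"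
  proof
    fix p assume p: "p \<in> [h ` S]\<^bsup>2\<^esup>"
    let ?q = "inv_into S h ` p"
    have "?q \<subseteq> f ?q" "f ?q \<in> [V]\<^bsup>3\<^esup>" "c (h ` f ?q) = i" using S(5) q[OF p] by auto
    then show "p \<subseteq> f' p \<and> f' p \<in> [h ` V]\<^bsup>3\<^esup> \<and> c (f' p) = i"
      unfolding f'_def using q[OF p] nsets_image_iff[OF h, of "f ?q" 3] fV by (metis image_mono)
  qed
  ultimately have "berge_clique c i (h ` V) (h ` S)"
    unfolding berge_clique_def using S(3) by blast
  then show ?thesis unfolding has_clique_def using S(1,2) hS by (metis card_image finite_imageI)
qed

text \<open>From left to right, core and hosts are pulled back along the isomorphism from
  \<open>H'\<close> to \<open>F\<close>. From right to left, the hosts themselves are the hyperedges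
  of a Berge copy on all \<open>N\<close> vertices, and the identity is the isomorphism.\<close>

lemma monochromatic_copy_iff_has_clique:
  "monochromatic_copy c i (complete_hypergraph 3 N) (berge_copies 3 (complete_graph k)) \<longleftrightarrow>
   has_clique c i {..<N} k"
proof
  assume "monochromatic_copy c i (complete_hypergraph 3 N) (berge_copies 3 (complete_graph k))"
  then obtain H' F where H': "subhypergraph H' (complete_hypergraph 3 N)" "\<forall>e\<in>hedges H'. c e = i"
    and F: "F \<in> berge_copies 3 (complete_graph k)" "hypergraph_iso H' F"
    unfolding monochromatic_copy_def by blast
  obtain h where h: "bij_betw h (hverts H') (hverts F)" "bij_betw ((`) h) (hedges H') (hedges F)"
    using F(2) unfolding hypergraph_iso_def by blast
  obtain \<phi> \<psi> where ph: "inj_on \<phi> {..<k}" "\<phi> ` {..<k} \<subseteq> hverts F"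
    and ps: "bij_betw \<psi> ([{..<k}]\<^bsup>2\<^esup>) (hedges F)"
    and inc: "\<And>u v. {u, v} \<in> [{..<k}]\<^bsup>2\<^esup> \<Longrightarrow> {\<phi> u, \<phi> v} \<subseteq> \<psi> {u, v}"
    using F(1) unfolding berge_copies_def complete_graph_def complete_hypergraph_def by auto
  have vert: "hverts H' \<subseteq> {..<N}" and edge: "hedges H' \<subseteq> [{..<N}]\<^bsup>3\<^esup>" "hedges H' \<subseteq> Pow (hverts H')"
    using H'(1) unfolding subhypergraph_def complete_hypergraph_def by auto
  \<comment> \<open>\<open>g\<close> places the vertices of the complete graph in \<open>H'\<close>:
    by \<open>\<phi>\<close> into \<open>F\<close>, then back along \<open>h\<close>.\<close>
  define g where "g = inv_into (hverts H') h \<circ> \<phi>"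
  have hg: "h (g u) = \<phi> u \<and> g u \<in> hverts H'" if "u < k" for u
    unfolding g_def using ph(2) h(1) that
    by (auto simp: bij_betw_def f_inv_into_f inv_into_into image_subset_iff)
  have ginj: "inj_on g {..<k}"
  proof (rule inj_onI)
    fix u v assume uv: "u \<in> {..<k}" "v \<in> {..<k}" "g u = g v"
    then have "\<phi> u = \<phi> v" using hg by (metis lessThan_iff)
    then show "u = v" using ph(1) uv(1,2) by (meson inj_onD)
  qed
  define S where "S = g ` {..<k}"
  \<comment> \<open>The host of a pair: name the pair by numbers below \<open>k\<close>, apply
    \<open>\<psi>\<close>, and return along the edge bijection that \<open>h\<close>
    induces.\<close>
  define f where "f = (\<lambda>p. inv_into (hedges H') ((`) h) (\<psi> (inv_into {..<k} g ` p)))"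
  have q: "inv_into {..<k} g ` p \<in> [{..<k}]\<^bsup>2\<^esup> \<and> g ` (inv_into {..<k} g ` p) = p" if "p \<in> [S]\<^bsup>2\<^esup>" for p
  proof -
    have p: "p \<subseteq> g ` {..<k}" using that by (auto simp: nsets_def S_def)
    then have "g ` (inv_into {..<k} g ` p) = p" by (simp add: image_inv_into_cancel)
    moreover have "inv_into {..<k} g ` p \<subseteq> {..<k}" using p by (meson image_subsetI inv_into_into subsetD)
    ultimately show ?thesis
      using nsets_image_iff[OF ginj, of "inv_into {..<k} g ` p" 2] that S_def by simp
  qed
  have f: "f p \<in> hedges H' \<and> h ` f p = \<psi> (inv_into {..<k} g ` p)" if "p \<in> [S]\<^bsup>2\<^esup>" for p
  proof -
    have "\<psi> (inv_into {..<k} g ` p) \<in> (`) h ` hedges H'"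
      using ps h(2) q[OF that] by (auto simp: bij_betw_def)
    then show ?thesis unfolding f_def by (metis f_inv_into_f inv_into_into)
  qed
  have "inj_on f ([S]\<^bsup>2\<^esup>)"
  proof (rule inj_onI)
    fix p p' assume p: "p \<in> [S]\<^bsup>2\<^esup>" "p' \<in> [S]\<^bsup>2\<^esup>" "f p = f p'"
    then have "\<psi> (inv_into {..<k} g ` p) = \<psi> (inv_into {..<k} g ` p')" using f by metis
    then have "inv_into {..<k} g ` p = inv_into {..<k} g ` p'"
      using ps q p unfolding bij_betw_def by (meson inj_onD)
    then show "p = p'" using q p by metis
  qed
  moreover have "\<forall>p \<in> [S]\<^bsup>2\<^esup>. p \<subseteq> f p \<and> f p \<in> [{..<N}]\<^bsup>3\<^esup> \<and> c (f p) = i"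
  proof
    fix p assume p: "p \<in> [S]\<^bsup>2\<^esup>"
    let ?q = "inv_into {..<k} g ` p"
    have fp: "f p \<in> hedges H'" "h ` f p = \<psi> ?q" using f p by auto
    have "card ?q = 2" using q[OF p] by (simp add: nsets_def)
    then obtain u v where uv: "?q = {u, v}" by (auto simp: card_2_iff)
    have k: "u < k" "v < k" using q[OF p] uv by (auto simp: nsets_def)
    \<comment> \<open>The incidence is known only after applying \<open>h\<close>; injectivity of
      \<open>h\<close> on the vertices of \<open>H'\<close> undoes this.\<close>
    have "{\<phi> u, \<phi> v} \<subseteq> h ` f p" using inc q[OF p] uv fp(2) by metis
    then have "{h (g u), h (g v)} \<subseteq> h ` f p" using hg k by simp
    moreover have "inj_on h (hverts H')" "f p \<subseteq> hverts H'" using h(1) fp(1) edge(2) by (auto simp: bij_betw_def)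
    ultimately have "{g u, g v} \<subseteq> f p" using hg k
      by (metis empty_subsetI inj_on_image_mem_iff insert_subset)
    moreover have "p = {g u, g v}" using q[OF p] uv by (metis image_empty image_insert)
    ultimately show "p \<subseteq> f p \<and> f p \<in> [{..<N}]\<^bsup>3\<^esup> \<and> c (f p) = i"
      using fp(1) edge(1) H'(2) by blast
  qed
  moreover have "S \<subseteq> {..<N}" "finite S" "card S = k"
    unfolding S_def using hg vert ginj by (auto simp: card_image)
  ultimately show "has_clique c i {..<N} k" unfolding has_clique_def berge_clique_def by blast
next
  assume "has_clique c i {..<N} k"
  then obtain S f where S: "finite S" "card S = k" "S \<subseteq> {..<N}" "inj_on f ([S]\<^bsup>2\<^esup>)"
    "\<forall>p \<in> [S]\<^bsup>2\<^esup>. p \<subseteq> f p \<and> f p \<in> [{..<N}]\<^bsup>3\<^esup> \<and> c (f p) = i"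
    unfolding has_clique_def berge_clique_def by blast
  obtain \<phi> where ph: "bij_betw \<phi> {..<k} S"
    using ex_bij_betw_nat_finite[OF S(1)] S(2) by (auto simp: atLeast0LessThan)
  then have inj: "inj_on \<phi> {..<k}" and im: "\<phi> ` {..<k} = S" by (auto simp: bij_betw_def)
  define H where "H = Hypergraph {..<N} (f ` [S]\<^bsup>2\<^esup>)"
  have bij: "bij_betw ((`) \<phi>) ([{..<k}]\<^bsup>2\<^esup>) ([S]\<^bsup>2\<^esup>)" using ph by (rule bij_betw_nsets)
  have "uniform_hypergraph 3 H" unfolding uniform_hypergraph_def H_def using S(5) by auto
  moreover have "bij_betw (f \<circ> (`) \<phi>) ([{..<k}]\<^bsup>2\<^esup>) (f ` [S]\<^bsup>2\<^esup>)"
    using bij S(4) by (meson bij_betw_imageI bij_betw_trans)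
  moreover have "\<forall>u v. {u, v} \<in> [{..<k}]\<^bsup>2\<^esup> \<longrightarrow> {\<phi> u, \<phi> v} \<subseteq> (f \<circ> (`) \<phi>) {u, v}"
  proof (intro allI impI)
    fix u v assume "{u, v} \<in> [{..<k}]\<^bsup>2\<^esup>"
    then have "\<phi> ` {u, v} \<in> [S]\<^bsup>2\<^esup>" using bij by (auto simp: bij_betw_def simp del: image_insert)
    then show "{\<phi> u, \<phi> v} \<subseteq> (f \<circ> (`) \<phi>) {u, v}" using S(5) by auto
  qed
  ultimately have "H \<in> berge_copies 3 (complete_graph k)"
    unfolding berge_copies_def complete_graph_def complete_hypergraph_def mem_Collect_eq
    using inj im S(3)
    by (intro conjI exI[of _ \<phi>] exI[of _ "f \<circ> (`) \<phi>"]) (simp_all add: H_def)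
  moreover have "hypergraph_iso H H" unfolding hypergraph_iso_def
    by (rule exI[of _ id]) (simp add: bij_betw_def)
  moreover have "subhypergraph H (complete_hypergraph 3 N)"
    unfolding subhypergraph_def complete_hypergraph_def H_def using S(5) by (auto simp: nsets_def)
  moreover have "\<forall>e\<in>hedges H. c e = i" unfolding H_def using S(5) by auto
  ultimately show "monochromatic_copy c i (complete_hypergraph 3 N) (berge_copies 3 (complete_graph k))"
    unfolding monochromatic_copy_def by blast
qed

section \<open>Links\<close>

text \<open>Connectedness is stated through cuts instead of paths. Its negation is then a cut whose
  crossing hyperedges all have the other colour, and the positive form directly supplies the next
  edge of a growing tree.\<close>

definition link_connected :: "('a set \<Rightarrow> colour) \<Rightarrow> colour \<Rightarrow> 'a set \<Rightarrow> 'a \<Rightarrow> bool" where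
  "link_connected c i V x \<longleftrightarrow>
     (\<forall>C. C \<subset> V - {x} \<longrightarrow> C \<noteq> {} \<longrightarrow> (\<exists>a \<in> C. \<exists>b \<in> V - {x} - C. c {x, a, b} = i))"

text \<open>Of a graph and its complement one is connected. Given a cut \<open>C\<close> for one
  colour and \<open>D\<close> for the other, a pair \<open>a\<close>, \<open>b\<close> separated by
  both would leave no colour for \<open>{x, a, b}\<close>; but two cuts always separate a common
  pair.\<close>

lemma link_connected_cases:
  "link_connected c First V x \<or> link_connected c Second V x"
proof (rule ccontr)
  assume "\<not> ?thesis"
  then have "\<not> link_connected c First V x" "\<not> link_connected c Second V x" by simp_all
  then obtain C D where C: "C \<subset> V - {x}" "C \<noteq> {}" "\<forall>a \<in> C. \<forall>b \<in> V - {x} - C. c {x, a, b} \<noteq> First"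
    and D: "D \<subset> V - {x}" "D \<noteq> {}" "\<forall>a \<in> D. \<forall>b \<in> V - {x} - D. c {x, a, b} \<noteq> Second"
    unfolding link_connected_def by metis
  have *: False if "a \<in> C" "b \<in> V - {x} - C" "(a \<in> D) \<noteq> (b \<in> D)" for a b
  proof -
    have "c {x, a, b} \<noteq> First" using C that by blast
    moreover have "c {x, a, b} \<noteq> Second"
    proof (cases "a \<in> D")
      case True
      then show ?thesis using D(3) that by blast
    next
      case False
      then have "c {x, b, a} \<noteq> Second" using D(3) that C(1) by blast
      then show ?thesis by (simp add: insert_commute)
    qed
    ultimately show False by (meson colour.exhaust)
  qed
  \<comment> \<open>\<open>a\<close> and \<open>b\<close> lie on different sides of \<open>C\<close>
    and on the same side of \<open>D\<close>. A vertex \<open>d\<close> on the other side of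
    \<open>D\<close> is separated by \<open>C\<close> from one of them.\<close>
  obtain a b where ab: "a \<in> C" "b \<in> V - {x} - C" using C by blast
  have "(a \<in> D) = (b \<in> D)" using * ab by blast
  moreover obtain d where "d \<in> V - {x}" "(d \<in> D) \<noteq> (a \<in> D)" using D by blast
  ultimately show False using * ab by (metis Diff_iff)
qed

lemma link_connected_image:
  assumes "inj_on h V" "x \<in> V" "link_connected (\<lambda>e. c (h ` e)) i V x"
  shows "link_connected c i (h ` V) (h x)"
  unfolding link_connected_def
proof (intro allI impI)
  fix C assume C: "C \<subset> h ` V - {h x}" "C \<noteq> {}"
  define C' where "C' = {v \<in> V - {x}. h v \<in> C}"
  have im: "h ` V - {h x} = h ` (V - {x})"
    using assms(1,2) by (auto simp: inj_on_eq_iff)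
  then have "C = h ` C'" using C unfolding C'_def by auto
  moreover have "C' \<subseteq> V - {x}" by (auto simp: C'_def)
  ultimately have "C' \<subset> V - {x}" "C' \<noteq> {}" using C im by auto
  then obtain a b where ab: "a \<in> C'" "b \<in> V - {x} - C'" "c (h ` {x, a, b}) = i"
    using assms(3) unfolding link_connected_def by blast
  have "h b \<notin> C" using ab(2) by (auto simp: C'_def)
  moreover have "h b \<noteq> h x" using ab(2) assms(1,2) by (auto simp: inj_on_eq_iff)
  ultimately show "\<exists>a\<in>C. \<exists>b\<in>h ` V - {h x} - C. c {h x, a, b} = i"
    using ab by (intro bexI[of _ "h a"] bexI[of _ "h b"]) (auto simp: C'_def)
qed

text \<open>A tree grows from the seed \<open>C\<close>, and each new vertex \<open>b\<close>
  receives the link edge through which it is reached. That edge contains \<open>b\<close> while all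
  earlier ones lie inside \<open>C\<close>, so injectivity persists. A general seed with its own
  assignment covers both a single root outside \<open>A\<close> and a triangle inside
  \<open>A\<close>.\<close>

lemma link_assignment:
  assumes "finite V" "link_connected c i V x" "A \<subseteq> V - {x}" "C \<subseteq> V - {x}" "C \<noteq> {}"
    and "inj_on g (A \<inter> C)" "\<forall>a \<in> A \<inter> C. a \<in> g a \<and> g a \<in> [C]\<^bsup>2\<^esup> \<and> c (insert x (g a)) = i"
  shows "\<exists>g. inj_on g A \<and> (\<forall>a \<in> A. a \<in> g a \<and> g a \<in> [V - {x}]\<^bsup>2\<^esup> \<and> c (insert x (g a)) = i)"
  using assms(4-)
\<comment> \<open>Induction on the number of vertices that the tree has not reached.\<close>
proof (induction "card (V - {x} - C)" arbitrary: C g)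
  case 0
  then have "C = V - {x}" using assms(1) by auto
  then show ?case using 0 assms(3) by (metis inf.absorb1)
next
  case (Suc n)
  then have "C \<subset> V - {x}" by (metis Diff_cancel card.empty nat.distinct(1) psubsetI)
  then obtain a b where ab: "a \<in> C" "b \<in> V - {x} - C" "c {x, a, b} = i"
    using assms(2) Suc.prems unfolding link_connected_def by blast
  define g' where "g' = g(b := {a, b})"
  have eq: "g' u = g u" if "u \<in> C" for u using that ab unfolding g'_def by auto
  show ?case
  proof (rule Suc.hyps(1)[of "insert b C" g'])
    have "V - {x} - C = insert b (V - {x} - insert b C)" using ab by auto
    then show "n = card (V - {x} - insert b C)"
      using Suc.hyps(2) assms(1) by (metis Diff_iff card_insert_disjoint finite_Diff insertI1 nat.inject)
    show "insert b C \<subseteq> V - {x}" using Suc.prems ab by auto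
    show "inj_on g' (A \<inter> insert b C)"
    proof (rule inj_onI)
      fix u v assume uv: "u \<in> A \<inter> insert b C" "v \<in> A \<inter> insert b C" "g' u = g' v"
      have "b \<notin> g u" if "u \<in> A \<inter> C" for u
        using Suc.prems(4) that ab by (auto simp: nsets_def)
      moreover have "b \<in> g' b" by (simp add: g'_def)
      ultimately have ne: "g' b \<noteq> g' u" if "u \<in> A \<inter> C" for u using that eq by auto
      show "u = v"
      proof (cases "u = b \<or> v = b")
        case True
        then show ?thesis using uv ne by (metis IntD1 IntD2 IntI insertE)
      next
        case False
        then have "u \<in> A \<inter> C" "v \<in> A \<inter> C" using uv by auto
        then show ?thesis using uv(3) eq Suc.prems(3) by (simp add: inj_on_eq_iff)
      qed
    qed
    have "g' b \<in> [insert b C]\<^bsup>2\<^esup> \<and> c (insert x (g' b)) = i" "b \<in> g' b"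
      using ab by (auto simp: g'_def nsets_def card_2_iff)
    moreover have "[C]\<^bsup>2\<^esup> \<subseteq> [insert b C]\<^bsup>2\<^esup>" by (rule nsets_mono) auto
    ultimately show "\<forall>a\<in>A \<inter> insert b C. a \<in> g' a \<and> g' a \<in> [insert b C]\<^bsup>2\<^esup> \<and> c (insert x (g' a)) = i"
      using Suc.prems(4) eq by auto
  qed simp
qed

text \<open>The new hosts contain \<open>x\<close> and the old ones avoid it, so the two kinds
  cannot collide; among the new ones, injectivity is that of \<open>g\<close>.\<close>

lemma berge_clique_insert:
  assumes x: "x \<in> V" and A: "berge_clique c i (V - {x}) A"
    and g: "inj_on g A" "\<forall>a \<in> A. a \<in> g a \<and> g a \<in> [V - {x}]\<^bsup>2\<^esup> \<and> c (insert x (g a)) = i"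
  shows "berge_clique c i V (insert x A)"
proof -
  obtain f where f: "inj_on f ([A]\<^bsup>2\<^esup>)"
    "\<forall>p \<in> [A]\<^bsup>2\<^esup>. p \<subseteq> f p \<and> f p \<in> [V - {x}]\<^bsup>3\<^esup> \<and> c (f p) = i" and AV: "A \<subseteq> V - {x}"
    using A unfolding berge_clique_def by blast
  \<comment> \<open>For a pair through \<open>x\<close>, \<open>the_elem\<close> extracts its other
    vertex.\<close>
  define f' where "f' = (\<lambda>p. if x \<in> p then insert x (g (the_elem (p - {x}))) else f p)"
  have cases: "(\<exists>a\<in>A. p = {x, a} \<and> f' p = insert x (g a)) \<or> p \<in> [A]\<^bsup>2\<^esup> \<and> f' p = f p"
    if p: "p \<in> [insert x A]\<^bsup>2\<^esup>" for p
  proof (cases "x \<in> p")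
    case True
    then obtain a where a: "p = {x, a}" "a \<noteq> x"
      using p by (auto simp: nsets_def card_2_iff)
    then have "p - {x} = {a}" "a \<in> A" using p by (auto simp: nsets_def)
    then show ?thesis using a True by (auto simp: f'_def)
  next
    case False
    then show ?thesis using p by (auto simp: f'_def nsets_def)
  qed
  have gx: "x \<notin> g a" if "a \<in> A" for a using g(2) that by (auto simp: nsets_def)
  have fx: "x \<notin> f p" if "p \<in> [A]\<^bsup>2\<^esup>" for p using f(2) that by (auto simp: nsets_def)
  have "inj_on f' ([insert x A]\<^bsup>2\<^esup>)"
  proof (rule inj_onI)
    fix p q assume pq: "p \<in> [insert x A]\<^bsup>2\<^esup>" "q \<in> [insert x A]\<^bsup>2\<^esup>" "f' p = f' q"
    show "p = q"
      using cases[OF pq(1)]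
    proof
      assume "\<exists>a\<in>A. p = {x, a} \<and> f' p = insert x (g a)"
      then obtain a where a: "a \<in> A" "p = {x, a}" "f' p = insert x (g a)" by blast
      then obtain b where b: "b \<in> A" "q = {x, b}" "f' q = insert x (g b)"
        using cases[OF pq(2)] fx pq(3) by (metis insertI1)
      have "g a = g b" using a b gx pq(3) by (metis insert_ident)
      then show "p = q" using a b g(1) by (metis inj_onD)
    next
      assume p: "p \<in> [A]\<^bsup>2\<^esup> \<and> f' p = f p"
      then have "q \<in> [A]\<^bsup>2\<^esup> \<and> f' q = f q" using cases[OF pq(2)] fx pq(3) by (metis insertI1)
      then show "p = q" using p f(1) pq(3) by (metis inj_onD)
    qed
  qed
  moreover have "\<forall>p \<in> [insert x A]\<^bsup>2\<^esup>. p \<subseteq> f' p \<and> f' p \<in> [V]\<^bsup>3\<^esup> \<and> c (f' p) = i"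
  proof
    fix p assume p: "p \<in> [insert x A]\<^bsup>2\<^esup>"
    show "p \<subseteq> f' p \<and> f' p \<in> [V]\<^bsup>3\<^esup> \<and> c (f' p) = i"
      using cases[OF p]
    proof
      assume "\<exists>a\<in>A. p = {x, a} \<and> f' p = insert x (g a)"
      then obtain a where a: "a \<in> A" "p = {x, a}" "f' p = insert x (g a)" by blast
      have "g a \<in> [V - {x}]\<^bsup>2\<^esup>" using g(2) a by blast
      then have "insert x (g a) \<in> [V]\<^bsup>3\<^esup>" using x gx[OF a(1)] by (auto simp: nsets_def)
      then show ?thesis using a g(2) by auto
    next
      assume "p \<in> [A]\<^bsup>2\<^esup> \<and> f' p = f p"
      moreover have "[V - {x}]\<^bsup>3\<^esup> \<subseteq> [V]\<^bsup>3\<^esup>" by (rule nsets_mono) auto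
      ultimately show ?thesis using f(2) by auto
    qed
  qed
  ultimately show ?thesis unfolding berge_clique_def using AV x by blast
qed

lemma has_clique_Suc:
  assumes "finite V" "x \<in> V" "link_connected c i V x" "has_clique c i (V - {x}) k" "Suc k < card V"
  shows "has_clique c i V (Suc k)"
proof -
  obtain A where A: "finite A" "card A = k" "berge_clique c i (V - {x}) A"
    using assms(4) unfolding has_clique_def by blast
  then have AV: "A \<subseteq> V - {x}" by (simp add: berge_clique_def)
  \<comment> \<open>The strict bound leaves a vertex \<open>r\<close> outside \<open>A\<close>: the
    root of the tree, which has no parent edge.\<close>
  have "card (V - {x}) > k" using assms by simp
  then obtain r where r: "r \<in> V - {x}" "r \<notin> A" using A(1,2) AV by (metis less_irrefl subsetI subset_antisym)
  \<comment> \<open>The seed \<open>{r}\<close> is disjoint from \<open>A\<close>, so nothing is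
    assigned on it and \<open>undefined\<close> can stand for the initial assignment.\<close>
  obtain g where "inj_on g A" "\<forall>a \<in> A. a \<in> g a \<and> g a \<in> [V - {x}]\<^bsup>2\<^esup> \<and> c (insert x (g a)) = i"
    using link_assignment[OF assms(1,3) AV, of "{r}" undefined] r by auto
  then have "berge_clique c i V (insert x A)" using berge_clique_insert assms(2) A(3) by metis
  moreover have "x \<notin> A" using AV by blast
  then have "card (insert x A) = Suc k" using A by simp
  ultimately show ?thesis unfolding has_clique_def using A(1) by (metis finite_insert)
qed

section \<open>The arrow relation\<close>

definition arrows :: "nat \<Rightarrow> nat \<Rightarrow> nat \<Rightarrow> bool" where
  "arrows n s t \<longleftrightarrow>
     (\<forall>c :: nat set \<Rightarrow> colour. has_clique c First {..<n} s \<or> has_clique c Second {..<n} t)"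

lemma arrowsD:
  fixes c :: "'a set \<Rightarrow> colour"
  assumes "arrows n s t" "finite V" "card V = n"
  shows "has_clique c First V s \<or> has_clique c Second V t"
proof -
  obtain h where "bij_betw h {..<n} V"
    using ex_bij_betw_nat_finite[OF assms(2)] assms(3) by (auto simp: atLeast0LessThan)
  then have "inj_on h {..<n}" "h ` {..<n} = V" by (auto simp: bij_betw_def)
  then show ?thesis using assms(1) has_clique_image[of h "{..<n}" c] unfolding arrows_def by metis
qed

section \<open>Five and six vertices\<close>

datatype 'l decision_tree = Leaf 'l | Split "nat set" "'l decision_tree" "'l decision_tree"

text \<open>\<open>R\<close> and \<open>B\<close> collect the hyperedges assumed to have the first
  and the second colour on the way down; \<open>T\<close> is the branch where \<open>e\<close> is
  \<open>First\<close>. The test at the leaves is a parameter because two kinds of certificate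
  occur.\<close>

fun closes ::
  "('l \<Rightarrow> nat set list \<Rightarrow> nat set list \<Rightarrow> bool) \<Rightarrow> nat set list \<Rightarrow> nat set list \<Rightarrow> 'l decision_tree \<Rightarrow> bool"
where
  "closes ok R B (Leaf l) \<longleftrightarrow> ok l R B"
| "closes ok R B (Split e T U) \<longleftrightarrow> closes ok (e # R) B T \<and> closes ok R (e # B) U"

text \<open>Walking down the tree by the actual colours of the queried hyperedges ends in a leaf
  whose two lists agree with \<open>c\<close>.\<close>

lemma closes_sound:
  assumes "closes ok R B T" "\<forall>e \<in> set R. c e = First" "\<forall>e \<in> set B. c e = Second"
  obtains l R' B' where "ok l R' B'" "\<forall>e \<in> set R'. c e = First" "\<forall>e \<in> set B'. c e = Second"
proof -
  have "\<exists>l R' B'. ok l R' B' \<and> (\<forall>e \<in> set R'. c e = First) \<and> (\<forall>e \<in> set B'. c e = Second)"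
    using assms
  proof (induction T arbitrary: R B)
    case (Leaf l)
    then show ?case by auto
  next
    case (Split e T U)
    show ?case
    proof (cases "c e")
      case First
      then show ?thesis using Split.IH(1)[of "e # R" B] Split.prems by simp
    next
      case Second
      then show ?thesis using Split.IH(2)[of R "e # B"] Split.prems by simp
    qed
  qed
  then show ?thesis using that by blast
qed

fun pairs :: "'a list \<Rightarrow> ('a \<times> 'a) list" where
  "pairs [] = []"
| "pairs (x # xs) = map (Pair x) xs @ pairs xs"

lemma pairs_complete:
  "a \<in> set xs \<Longrightarrow> b \<in> set xs \<Longrightarrow> a \<noteq> b \<Longrightarrow> (a, b) \<in> set (pairs xs) \<or> (b, a) \<in> set (pairs xs)"
  by (induction xs) auto

lemma pairs_distinct:
  "distinct xs \<Longrightarrow> (a, b) \<in> set (pairs xs) \<Longrightarrow> a \<noteq> b \<and> a \<in> set xs \<and> b \<in> set xs"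
  by (induction xs) auto

text \<open>The list \<open>ws\<close> names, for each pair of core vertices, the third vertex of its hyperedge.\<close>

definition clique_witness :: "nat set list \<Rightarrow> nat list \<Rightarrow> nat list \<Rightarrow> bool" where
  "clique_witness E xs ws \<longleftrightarrow> distinct xs \<and> length ws = length (pairs xs) \<and>
     (\<forall>((a, b), w) \<in> set (zip (pairs xs) ws). w \<noteq> a \<and> w \<noteq> b) \<and>
     (let ts = map2 (\<lambda>(a, b) w. {a, b, w}) (pairs xs) ws in distinct ts \<and> list_all (List.member E) ts)"

text \<open>The host of a pair is the entry of \<open>ts\<close> at the position of that pair. As
  \<open>ts\<close> is distinct, equal hosts force equal positions and hence equal pairs.\<close>

lemma clique_witness_has_clique:
  assumes "clique_witness E xs ws" "\<forall>e \<in> set E. c e = i"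
  shows "has_clique c i (set xs \<union> set ws) (length xs)"
proof -
  define ts where "ts = map2 (\<lambda>(a, b) w. {a, b, w}) (pairs xs) ws"
  have w: "distinct xs" "length ws = length (pairs xs)" "distinct ts" "\<forall>t \<in> set ts. t \<in> set E"
    and tri: "\<forall>((a, b), w) \<in> set (zip (pairs xs) ws). w \<noteq> a \<and> w \<noteq> b"
    using assms(1) unfolding clique_witness_def ts_def Let_def by (auto simp: list_all_iff)
  have len: "length ts = length (pairs xs)" using w by (simp add: ts_def)
  \<comment> \<open>\<open>pairs xs\<close> lists every pair in one order only, so the position is
    looked up through the unordered pair.\<close>
  define ix where "ix = (\<lambda>p. SOME j. j < length ts \<and> p = (case pairs xs ! j of (a, b) \<Rightarrow> {a, b}))"
  have ix: "ix p < length ts \<and> p = (case pairs xs ! ix p of (a, b) \<Rightarrow> {a, b})" if "p \<in> [set xs]\<^bsup>2\<^esup>" for p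
  proof -
    have "card p = 2" "p \<subseteq> set xs" using that by (simp_all add: nsets_def)
    then obtain a b where ab: "p = {a, b}" "a \<noteq> b" "a \<in> set xs" "b \<in> set xs"
      by (auto simp: card_2_iff)
    then obtain q where "q \<in> set (pairs xs)" "p = (case q of (a, b) \<Rightarrow> {a, b})"
      using pairs_complete[of a xs b] by (auto simp: insert_commute)
    then have "\<exists>j. j < length ts \<and> p = (case pairs xs ! j of (a, b) \<Rightarrow> {a, b})"
      unfolding len by (metis in_set_conv_nth)
    then show ?thesis unfolding ix_def by (rule someI_ex)
  qed
  have edge: "p \<subseteq> ts ! ix p \<and> ts ! ix p \<in> [set xs \<union> set ws]\<^bsup>3\<^esup> \<and> c (ts ! ix p) = i" if p: "p \<in> [set xs]\<^bsup>2\<^esup>" for p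
  proof -
    obtain a b where ab: "pairs xs ! ix p = (a, b)" by fastforce
    define v where "v = ws ! ix p"
    have j: "ix p < length (pairs xs)" "ix p < length ws" using ix[OF p] len w(2) by auto
    have t: "ts ! ix p = {a, b, v}" unfolding ts_def v_def using j ab by simp
    have "((a, b), v) \<in> set (zip (pairs xs) ws)"
      unfolding in_set_conv_nth by (rule exI[of _ "ix p"]) (use j ab v_def in simp)
    then have "v \<noteq> a" "v \<noteq> b" using tri by auto
    moreover have "a \<noteq> b \<and> a \<in> set xs \<and> b \<in> set xs"
      using pairs_distinct[OF w(1)] j ab by (metis nth_mem)
    moreover have "v \<in> set ws" using j v_def by simp
    ultimately have "{a, b, v} \<in> [set xs \<union> set ws]\<^bsup>3\<^esup>" by (auto simp: nsets_def)
    moreover have "c (ts ! ix p) = i" using w(4) assms(2) ix[OF p] by simp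
    ultimately show ?thesis using ix[OF p] ab t by auto
  qed
  have "inj_on (\<lambda>p. ts ! ix p) ([set xs]\<^bsup>2\<^esup>)"
  proof (rule inj_onI)
    fix p q assume pq: "p \<in> [set xs]\<^bsup>2\<^esup>" "q \<in> [set xs]\<^bsup>2\<^esup>" "ts ! ix p = ts ! ix q"
    then have "ix p = ix q" using ix w(3) by (simp add: nth_eq_iff_index_eq)
    then show "p = q" using ix pq(1,2) by metis
  qed
  then have "berge_clique c i (set xs \<union> set ws) (set xs)"
    unfolding berge_clique_def using edge by blast
  then show ?thesis unfolding has_clique_def using w(1) distinct_card by blast
qed

text \<open>A leaf does not name its colour; in the instances used, \<open>s\<close> and
  \<open>t\<close> differ and the size of the core decides it.\<close>

definition clique_leaf ::
  "nat \<Rightarrow> nat \<Rightarrow> nat \<Rightarrow> nat list \<times> nat list \<Rightarrow> nat set list \<Rightarrow> nat set list \<Rightarrow> bool" where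
  "clique_leaf n s t = (\<lambda>(xs, ws) R B. list_all (\<lambda>v. v < n) (xs @ ws) \<and>
     (length xs = s \<and> clique_witness R xs ws \<or> length xs = t \<and> clique_witness B xs ws))"

lemma clique_leaf_sound:
  assumes "clique_leaf n s t l R B" "\<forall>e \<in> set R. c e = First" "\<forall>e \<in> set B. c e = Second"
  shows "has_clique c First {..<n} s \<or> has_clique c Second {..<n} t"
proof -
  obtain xs ws where l: "l = (xs, ws)" by fastforce
  have sub: "set xs \<union> set ws \<subseteq> {..<n}"
    using assms(1) by (auto simp: clique_leaf_def l list_all_iff)
  consider "length xs = s" "clique_witness R xs ws" | "length xs = t" "clique_witness B xs ws"
    using assms(1) by (auto simp: clique_leaf_def l)
  then show ?thesis
    using clique_witness_has_clique has_clique_mono[OF _ sub order_refl] assms(2,3) by metis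
qed

lemma closes_clique_leaf:
  assumes "closes (clique_leaf n s t) R B T" "\<forall>e \<in> set R. c e = First" "\<forall>e \<in> set B. c e = Second"
  shows "has_clique c First {..<n} s \<or> has_clique c Second {..<n} t"
  by (rule closes_sound[OF assms]) (rule clique_leaf_sound)

text \<open>A leaf \<open>([v], [])\<close> claims that the link of \<open>v\<close> in the first colour is connected;
  any other leaf claims a Berge \<open>K\<^sub>4\<close> of the second colour that misses one of the six vertices.\<close>

definition link_leaf :: "nat list \<times> nat list \<Rightarrow> nat set list \<Rightarrow> nat set list \<Rightarrow> bool" where
  "link_leaf = (\<lambda>(xs, ws) R B. list_all (\<lambda>v. v < 6) (xs @ ws) \<and> (case xs of
     [v] \<Rightarrow> (\<forall>C \<in> set (subseqs (removeAll v [0..<6])).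
               C = [] \<or> set (removeAll v [0..<6]) \<subseteq> set C \<or>
               (\<exists>a \<in> set C. \<exists>b \<in> set (removeAll v [0..<6]). b \<notin> set C \<and> List.member R {v, a, b}))
   | _ \<Rightarrow> length xs = 4 \<and> card (set (xs @ ws)) \<le> 5 \<and> clique_witness B xs ws))"

lemma link_leaf_sound:
  assumes "link_leaf l R B" "\<forall>e \<in> set R. c e = First" "\<forall>e \<in> set B. c e = Second"
  shows "\<exists>v < 6. link_connected c First {..<6} v \<or> has_clique c Second ({..<6} - {v}) 4"
proof -
  obtain xs ws where l: "l = (xs, ws)" by fastforce
  have lt: "\<forall>v \<in> set (xs @ ws). v < 6" using assms(1) by (auto simp: link_leaf_def l list_all_iff)
  show ?thesis
  proof (cases "\<exists>v. xs = [v]")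
    case True
    then obtain v where v: "xs = [v]" by blast
    let ?W = "removeAll v [0..<6]"
    have W: "set ?W = {..<6} - {v}" by auto
    have cut: "\<exists>a \<in> C. \<exists>b \<in> {..<6} - {v} - C. c {v, a, b} = First" if C: "C \<subset> {..<6} - {v}" "C \<noteq> {}" for C
    proof -
      \<comment> \<open>Every cut occurs in the finite check as the set of some subsequence of the
        remaining vertices.\<close>
      have "C \<in> set ` set (subseqs ?W)" using C W by (simp only: subseqs_powset) blast
      then obtain Cl where Cl: "Cl \<in> set (subseqs ?W)" "C = set Cl" by blast
      have "Cl = [] \<or> set ?W \<subseteq> set Cl \<or> (\<exists>a \<in> set Cl. \<exists>b \<in> set ?W. b \<notin> set Cl \<and> {v, a, b} \<in> set R)"
        using assms(1) Cl(1) unfolding link_leaf_def l v by auto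
      moreover have "Cl \<noteq> []" "\<not> set ?W \<subseteq> set Cl" using C Cl(2) W by auto
      ultimately show ?thesis using Cl(2) W assms(2) by auto
    qed
    then have "link_connected c First {..<6} v" unfolding link_connected_def by blast
    moreover have "v < 6" using lt v by simp
    ultimately show ?thesis by blast
  next
    case False
    then have w: "length xs = 4" "card (set (xs @ ws)) \<le> 5" "clique_witness B xs ws"
      using assms(1) by (auto simp: link_leaf_def l split: list.splits)
    \<comment> \<open>Core and third vertices occupy at most five of the six vertices, which leaves
      a vertex \<open>v\<close> to remove.\<close>
    have "\<not> {..<6} \<subseteq> set (xs @ ws)"
      using w(2) card_mono[of "set (xs @ ws)" "{..<6::nat}"] by auto
    then obtain v where v: "v < 6" "v \<notin> set (xs @ ws)" by blast
    have "has_clique c Second (set xs \<union> set ws) 4"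
      using clique_witness_has_clique[OF w(3) assms(3)] w(1) by simp
    moreover have "set xs \<union> set ws \<subseteq> {..<6} - {v}" using lt v by auto
    ultimately show ?thesis using v(1) has_clique_mono by blast
  qed
qed

lemma closes_link_leaf:
  assumes "closes link_leaf R B T" "\<forall>e \<in> set R. c e = First" "\<forall>e \<in> set B. c e = Second"
  shows "\<exists>v < 6. link_connected c First {..<6} v \<or> has_clique c Second ({..<6} - {v}) 4"
  by (rule closes_sound[OF assms]) (rule link_leaf_sound)

text \<open>Vertex \<open>5\<close> plays the role of \<open>x\<close>: its link of colour \<open>i\<close> contains \<open>K\<^sub>1\<^sub>,\<^sub>4\<close> or \<open>K\<^sub>2\<^sub>,\<^sub>3\<close>.\<close>

lemma not_link_connected_normal_form:
  assumes "card V = 6" "x \<in> V" "\<not> link_connected c j V x" "i \<noteq> j"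
  obtains h :: "nat \<Rightarrow> 'a" where "inj_on h {..<6}" "h ` {..<6} = V"
    "(\<forall>e \<in> set [{5,0,1},{5,0,2},{5,0,3},{5,0,4}]. c (h ` e) = i) \<or>
     (\<forall>e \<in> set [{5,0,2},{5,0,3},{5,0,4},{5,1,2},{5,1,3},{5,1,4}]. c (h ` e) = i)"
proof -
  have fin: "finite V" using assms(1) card_ge_0_finite by force
  obtain C where C: "C \<subset> V - {x}" "C \<noteq> {}" "\<forall>a \<in> C. \<forall>b \<in> V - {x} - C. c {x, a, b} \<noteq> j"
    using assms(3) unfolding link_connected_def by metis
  have colour: "c e = i" if "c e \<noteq> j" for e
    using that assms(4) by (cases "c e"; cases i; cases j) auto
  define D where "D = V - {x} - C"
  have D: "D \<noteq> {}" "C \<inter> D = {}" "C \<union> D = V - {x}" using C by (auto simp: D_def)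
  have fCD: "finite C" "finite D" using D(3) fin by (metis finite_Diff finite_Un)+
  have "card C + card D = 5"
    using card_Un_disjoint[OF fCD D(2)] D(3) assms(1,2) fin by simp
  moreover have "card C \<noteq> 0" "card D \<noteq> 0" using C(2) D(1) fCD by auto
  \<comment> \<open>The two sides of the cut have five vertices together, so one side has one or
    two; that side becomes \<open>A\<close>.\<close>
  ultimately consider "card C \<in> {1, 2}" "card D = 5 - card C" | "card D \<in> {1, 2}" "card C = 5 - card D"
    by fastforce
  then obtain A B where AB: "A \<union> B = V - {x}" "A \<inter> B = {}" "card A \<in> {1, 2}" "card B = 5 - card A"
    "\<forall>a \<in> A. \<forall>b \<in> B. c {x, a, b} = i"
  proof cases
    case 1
    then show ?thesis using that[of C D] D C(3) colour unfolding D_def by simp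
  next
    case 2
    moreover have "c {x, a, b} = i" if "a \<in> D" "b \<in> C" for a b
    proof -
      have "c {x, b, a} = i" using that C(3) colour unfolding D_def by simp
      then show ?thesis by (simp add: insert_commute)
    qed
    ultimately show ?thesis using that[of D C] D by (simp add: Int_commute Un_commute)
  qed
  have "finite A" "finite B" using AB(1) fin by (metis finite_Diff finite_Un)+
  then obtain as bs where l: "distinct as" "set as = A" "length as = card A"
    "distinct bs" "set bs = B" "length bs = card B"
    using finite_distinct_list[of A] finite_distinct_list[of B] distinct_card by metis
  \<comment> \<open>Smaller side first and \<open>x\<close> last: \<open>x\<close> gets index
    \<open>5\<close>, and the two sides get the index blocks of the normal forms.\<close>
  define L where "L = as @ bs @ [x]"
  have "distinct L" "set L = V" "length L = 6"
    using l AB assms(2) by (auto simp: L_def)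
  then have "bij_betw ((!) L) {..<6} V" by (intro bij_betw_nth) auto
  then have h: "inj_on ((!) L) {..<6}" "(!) L ` {..<6} = V" by (auto simp: bij_betw_def)
  consider "length as = 1" "length bs = 4" | "length as = 2" "length bs = 3"
    using AB(3,4) l by auto
  then have "(\<forall>e \<in> set [{5,0,1},{5,0,2},{5,0,3},{5,0,4}]. c ((!) L ` e) = i) \<or>
     (\<forall>e \<in> set [{5,0,2},{5,0,3},{5,0,4},{5,1,2},{5,1,3},{5,1,4}]. c ((!) L ` e) = i)"
  proof cases
    case 1
    then obtain p q r s t where "as = [p]" "bs = [q, r, s, t]"
      by (auto simp: length_Suc_conv eval_nat_numeral)
    then show ?thesis using AB(5) l(2,5) by (auto simp: L_def)
  next
    case 2
    then obtain p q r s t where "as = [p, q]" "bs = [r, s, t]"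
      by (auto simp: length_Suc_conv eval_nat_numeral)
    then show ?thesis using AB(5) l(2,5) by (auto simp: L_def)
  qed
  then show ?thesis using h that[of "(!) L"] by blast
qed

text \<open>A case distinction on the colours of the ten hyperedges. Besides \<open>(3, 4)\<close>
  it yields \<open>(3, 3)\<close> by monotonicity and serves on five of the six vertices in
  \<open>arrows_6_4_5\<close>.\<close>

lemma arrows_5_3_4: "arrows 5 3 4"
proof -
  have "closes (clique_leaf 5 3 4) [] []
    (Split {0,3,4} (Split {1,2,4} (Split {0,1,2} (Leaf ([0,1,4],[2,3,2])) (Split {0,1,3} (Leaf
     ([1,3,4],[0,2,0])) (Split {0,1,4} (Leaf ([0,1,4],[4,3,2])) (Split {0,2,3} (Leaf
     ([0,2,4],[3,3,1])) (Split {0,2,4} (Leaf ([0,2,4],[4,3,1])) (Split {1,2,3} (Leaf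
     ([1,3,4],[2,2,0])) (Leaf ([0,1,2,3],[4,4,1,0,2,0])))))))) (Split {0,1,2} (Split {0,1,3} (Leaf
     ([0,1,3],[2,4,0])) (Split {0,1,4} (Leaf ([0,1,4],[2,3,0])) (Split {0,2,3} (Leaf
     ([0,2,3],[1,4,0])) (Split {0,2,4} (Leaf ([0,2,4],[1,3,0])) (Split {1,2,3} (Leaf
     ([0,2,3],[1,4,1])) (Leaf ([0,1,2,3],[4,4,1,4,2,0]))))))) (Split {1,2,3} (Split {0,1,3} (Leaf
     ([0,1,3],[3,4,2])) (Split {0,1,4} (Leaf ([0,1,3],[4,4,2])) (Split {0,2,3} (Leaf
     ([0,2,3],[3,4,1])) (Split {0,2,4} (Leaf ([0,2,3],[4,4,1])) (Leaf ([0,1,2,4],[3,3,2,0,0,1]))))))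
     (Split {2,3,4} (Split {0,1,3} (Leaf ([0,3,4],[1,3,2])) (Split {0,1,4} (Leaf ([0,3,4],[4,1,2]))
     (Split {0,2,3} (Leaf ([2,3,4],[0,3,0])) (Leaf ([0,1,2,3],[4,1,2,4,0,1]))))) (Split {0,1,3}
     (Split {0,1,4} (Leaf ([1,3,4],[0,0,0])) (Split {0,2,4} (Leaf ([0,3,4],[1,2,0])) (Leaf
     ([0,1,2,4],[2,4,1,3,2,3])))) (Split {0,1,4} (Split {0,2,3} (Leaf ([0,3,4],[2,1,0])) (Leaf
     ([0,1,2,3],[2,3,1,4,2,4]))) (Leaf ([0,1,3,4],[2,1,1,2,2,2])))))))) (Split {0,2,4} (Split
     {1,3,4} (Split {0,1,2} (Leaf ([1,2,4],[0,3,0])) (Split {0,1,3} (Leaf ([0,3,4],[1,2,1])) (Split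
     {0,1,4} (Leaf ([0,1,4],[4,2,3])) (Split {0,2,3} (Leaf ([0,3,4],[2,2,1])) (Split {1,2,3} (Leaf
     ([1,2,4],[3,3,0])) (Leaf ([0,1,2,3],[4,1,4,3,0,0]))))))) (Split {0,1,3} (Split {0,1,2} (Leaf
     ([0,1,2],[3,4,0])) (Split {0,1,4} (Leaf ([0,1,4],[3,2,0])) (Split {0,2,3} (Leaf
     ([0,2,3],[4,1,0])) (Split {1,2,3} (Leaf ([0,1,2],[3,4,3])) (Leaf ([0,1,2,3],[4,1,4,3,4,0]))))))
     (Split {1,2,3} (Split {0,1,2} (Leaf ([0,1,2],[2,4,3])) (Split {0,1,4} (Leaf ([0,1,2],[4,4,3]))
     (Split {0,2,3} (Leaf ([0,2,3],[4,2,1])) (Leaf ([0,1,3,4],[2,2,3,0,0,1]))))) (Split {0,1,2}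
     (Split {0,1,4} (Leaf ([0,1,4],[2,2,0])) (Split {1,2,4} (Leaf ([0,1,4],[2,2,2])) (Leaf
     ([0,1,3,4],[4,1,3,2,2,1])))) (Split {0,1,4} (Split {0,2,3} (Leaf ([0,2,4],[3,1,0])) (Leaf
     ([0,1,2,3],[3,3,4,0,4,1]))) (Leaf ([0,1,3,4],[2,1,1,2,3,0]))))))) (Split {1,2,4} (Split {0,2,3}
     (Split {0,1,2} (Leaf ([0,1,2],[2,3,4])) (Split {0,1,3} (Leaf ([1,2,3],[4,0,0])) (Split {0,1,4}
     (Leaf ([0,2,4],[3,1,1])) (Split {1,2,3} (Leaf ([1,2,3],[4,2,0])) (Leaf
     ([0,1,2,4],[3,1,3,3,0,0])))))) (Split {0,1,3} (Split {0,1,2} (Leaf ([0,1,2],[3,1,4])) (Split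
     {0,1,4} (Leaf ([0,1,4],[3,1,2])) (Split {1,2,3} (Leaf ([1,2,3],[4,0,1])) (Leaf
     ([1,2,3,4],[0,2,0,0,0,0]))))) (Split {0,1,4} (Split {0,1,2} (Leaf ([0,1,4],[2,1,2])) (Split
     {1,2,3} (Leaf ([1,2,4],[3,0,1])) (Leaf ([0,1,2,3],[2,4,4,3,0,0])))) (Split {0,1,2} (Split
     {1,3,4} (Leaf ([1,2,4],[0,3,1])) (Leaf ([0,1,3,4],[3,2,2,4,0,0]))) (Leaf
     ([1,2,3,4],[0,0,0,0,0,0])))))) (Split {0,2,3} (Split {0,1,4} (Split {0,1,2} (Leaf
     ([0,1,2],[4,3,0])) (Split {0,1,3} (Leaf ([0,1,3],[4,2,0])) (Split {1,2,3} (Leaf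
     ([0,1,2],[4,3,3])) (Leaf ([0,1,2,3],[2,4,4,4,0,1]))))) (Split {1,3,4} (Split {0,1,2} (Leaf
     ([0,1,3],[2,2,4])) (Split {0,1,3} (Leaf ([0,1,3],[3,2,4])) (Leaf ([0,1,2,4],[3,1,3,4,0,0]))))
     (Split {0,1,2} (Split {0,1,3} (Leaf ([0,2,3],[1,1,0])) (Leaf ([0,1,3,4],[4,1,2,4,2,0]))) (Leaf
     ([0,1,2,4],[4,1,3,4,3,0]))))) (Split {0,1,4} (Split {0,1,3} (Split {1,2,3} (Leaf
     ([0,1,3],[4,1,2])) (Split {1,3,4} (Leaf ([0,1,4],[3,1,3])) (Leaf ([0,2,3,4],[3,4,2,1,1,1]))))
     (Split {0,1,2} (Split {1,2,3} (Leaf ([0,1,2],[4,1,3])) (Leaf ([1,2,3,4],[3,0,2,0,0,0]))) (Leaf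
     ([1,2,3,4],[0,0,2,0,0,0])))) (Split {0,1,2} (Split {0,1,3} (Split {1,2,3} (Leaf
     ([0,1,3],[2,1,2])) (Leaf ([0,1,2,4],[4,3,3,3,2,0]))) (Leaf ([0,1,2,3],[4,4,4,4,0,0]))) (Leaf
     ([0,1,2,4],[2,3,3,4,0,0]))))))))"
    by code_simp
  from closes_clique_leaf[OF this] show ?thesis by (simp add: arrows_def)
qed

text \<open>This is the shape left by a vertex that is isolated in the second link of
  \<open>5\<close>. The star fixes four of the twenty hyperedges, so sixteen remain to branch
  on.\<close>

lemma first_star_arrows:
  fixes c :: "nat set \<Rightarrow> colour"
  assumes "\<forall>e \<in> set [{5,0,1},{5,0,2},{5,0,3},{5,0,4}]. c e = First"
  shows "has_clique c First {..<6} 4 \<or> has_clique c Second {..<6} 5"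
proof -
  have "closes (clique_leaf 6 4 5) [{5,0,1},{5,0,2},{5,0,3},{5,0,4}] []
    (Split {3,4,5} (Split {0,1,2} (Split {0,1,3} (Leaf ([0,1,3,5],[2,5,2,0,0,4])) (Split {0,1,4}
     (Leaf ([0,1,4,5],[2,5,2,0,0,3])) (Split {0,2,3} (Leaf ([0,2,3,5],[1,5,1,0,0,4])) (Split {0,2,4}
     (Leaf ([0,2,4,5],[1,5,1,0,0,3])) (Split {1,2,3} (Leaf ([0,2,3,5],[1,5,1,1,0,4])) (Split {1,2,4}
     (Leaf ([0,2,4,5],[1,5,1,1,0,3])) (Split {1,3,4} (Leaf ([0,1,3,5],[2,5,2,4,0,4])) (Split {1,3,5}
     (Leaf ([0,1,3,5],[2,5,2,5,0,4])) (Split {1,4,5} (Leaf ([0,1,4,5],[2,5,2,5,0,3])) (Split {2,3,4}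
     (Leaf ([0,2,3,5],[1,5,1,4,0,4])) (Leaf ([0,1,2,3,4],[3,4,2,1,3,5,5,4,1,1])))))))))))) (Split
     {0,1,4} (Split {0,1,3} (Leaf ([1,3,4,5],[0,0,0,5,0,0])) (Split {0,2,3} (Leaf
     ([0,3,4,5],[2,1,1,5,0,0])) (Split {0,3,4} (Leaf ([0,3,4,5],[4,1,1,5,0,0])) (Split {1,2,3} (Leaf
     ([0,1,3,5],[4,5,2,2,0,4])) (Split {1,2,4} (Leaf ([0,1,4,5],[4,5,2,2,0,3])) (Split {1,2,5} (Leaf
     ([0,1,4,5],[5,5,2,0,2,3])) (Split {1,3,4} (Leaf ([0,1,3,5],[4,5,2,4,0,4])) (Split {1,3,5} (Leaf
     ([0,3,4,5],[5,1,1,5,1,0])) (Split {1,4,5} (Leaf ([0,1,4,5],[4,5,2,5,0,3])) (Leaf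
     ([0,1,2,3,4],[2,3,1,3,5,5,5,1,1,1]))))))))))) (Split {1,2,4} (Split {0,1,3} (Leaf
     ([0,1,4,5],[3,5,2,2,0,3])) (Split {0,2,3} (Leaf ([0,2,3,4],[5,5,5,0,1,5])) (Split {0,2,4} (Leaf
     ([0,2,4,5],[4,5,1,1,0,3])) (Split {1,2,3} (Leaf ([0,2,3,4],[5,5,5,1,1,5])) (Split {1,2,5} (Leaf
     ([0,1,4,5],[5,5,2,2,2,3])) (Split {1,3,4} (Leaf ([0,1,3,4],[5,5,5,4,2,5])) (Split {1,3,5} (Leaf
     ([0,1,3,4],[5,5,5,5,2,5])) (Split {1,4,5} (Leaf ([0,1,4,5],[5,5,2,2,4,3])) (Leaf
     ([0,1,2,3,4],[2,3,1,1,5,5,5,1,0,1])))))))))) (Split {1,2,5} (Split {0,1,3} (Leaf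
     ([0,1,3,5],[5,5,2,0,2,4])) (Split {0,2,3} (Leaf ([0,2,3,5],[5,5,1,0,1,4])) (Split {0,2,4} (Leaf
     ([0,2,4,5],[5,5,1,0,1,3])) (Split {1,2,3} (Leaf ([0,1,3,5],[5,5,2,2,2,4])) (Split {1,3,4} (Leaf
     ([0,1,4,5],[5,5,2,3,2,3])) (Split {1,3,5} (Leaf ([0,1,3,5],[5,5,2,5,2,4])) (Split {1,4,5} (Leaf
     ([0,1,4,5],[5,5,2,5,2,3])) (Leaf ([0,1,2,3,4],[4,1,1,2,3,5,5,0,1,1]))))))))) (Split {0,1,3}
     (Split {0,2,4} (Leaf ([0,3,4,5],[1,2,1,5,0,0])) (Split {0,3,4} (Leaf ([0,3,4,5],[1,3,1,5,0,0]))
     (Split {1,2,3} (Leaf ([0,1,3,5],[3,5,2,2,0,4])) (Split {1,3,4} (Leaf ([0,1,3,5],[3,5,2,4,0,4]))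
     (Split {1,3,5} (Leaf ([0,1,3,5],[3,5,2,5,0,4])) (Split {1,4,5} (Leaf ([0,1,4,5],[3,5,2,5,0,3]))
     (Leaf ([0,1,2,3,4],[2,4,4,1,5,5,5,1,1,1])))))))) (Split {1,2,3} (Split {0,2,3} (Leaf
     ([0,2,3,5],[3,5,1,1,0,4])) (Split {0,2,4} (Leaf ([2,3,4,5],[1,0,0,5,0,0])) (Split {1,3,4} (Leaf
     ([0,1,3,4],[5,5,5,2,3,5])) (Split {1,3,5} (Leaf ([0,1,3,5],[5,5,2,2,3,4])) (Split {1,4,5} (Leaf
     ([0,1,3,4],[5,5,5,2,5,5])) (Leaf ([0,1,2,3,4],[4,1,1,2,5,5,5,0,1,1]))))))) (Split {2,4,5}
     (Split {0,2,3} (Leaf ([0,2,3,4],[5,5,5,0,5,5])) (Split {0,2,4} (Leaf ([0,2,4,5],[4,5,1,5,0,3]))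
     (Split {0,3,4} (Leaf ([0,3,4,5],[4,5,1,5,0,2])) (Split {1,3,4} (Leaf ([0,3,4,5],[5,5,1,1,4,2]))
     (Leaf ([0,1,2,3,4],[3,1,2,2,5,4,0,1,1,0])))))) (Split {1,3,5} (Split {0,2,4} (Leaf
     ([0,3,4,5],[5,2,1,5,1,0])) (Split {0,3,4} (Leaf ([0,3,4,5],[5,3,1,5,1,0])) (Split {1,3,4} (Leaf
     ([0,1,4,5],[5,5,2,3,3,3])) (Leaf ([0,1,2,3,4],[2,4,1,1,5,4,2,1,5,0]))))) (Split {2,3,4} (Split
     {0,2,3} (Leaf ([0,3,4,5],[2,5,1,2,0,3])) (Split {0,3,4} (Leaf ([0,3,4,5],[4,5,1,2,0,3])) (Leaf
     ([0,1,2,3,4],[2,3,1,1,5,5,2,1,5,0])))) (Split {0,2,3} (Split {0,2,4} (Leaf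
     ([0,2,3,5],[4,5,1,0,0,4])) (Leaf ([0,1,2,3,4],[2,4,1,1,5,5,2,1,5,2]))) (Leaf
     ([0,1,2,3,4],[2,3,1,1,5,5,2,1,5,2])))))))))))) (Split {0,1,2} (Split {1,3,4} (Split {0,1,3}
     (Leaf ([0,1,3,5],[2,1,2,4,0,0])) (Split {0,1,4} (Leaf ([0,1,4,5],[2,1,2,3,0,0])) (Split {0,2,3}
     (Leaf ([0,1,3,5],[2,2,2,4,0,0])) (Split {0,2,4} (Leaf ([1,2,4,5],[0,3,0,0,0,0])) (Split {0,3,4}
     (Leaf ([0,1,4,5],[2,3,2,3,0,0])) (Split {1,2,3} (Leaf ([1,2,3,5],[0,4,0,1,0,0])) (Split {1,2,4}
     (Leaf ([1,2,4,5],[0,3,0,1,0,0])) (Split {1,3,5} (Leaf ([0,1,3,5],[2,5,2,4,0,1])) (Split {1,4,5}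
     (Leaf ([0,1,4,5],[2,5,2,3,0,1])) (Leaf ([0,1,2,3,4],[3,3,4,1,4,5,5,1,0,5]))))))))))) (Split
     {2,3,4} (Split {0,1,3} (Leaf ([1,2,3,5],[0,0,0,4,0,0])) (Split {0,1,4} (Leaf
     ([0,2,4,5],[1,1,1,3,0,0])) (Split {0,2,3} (Leaf ([0,2,3,5],[1,2,1,4,0,0])) (Split {0,2,4} (Leaf
     ([0,2,4,5],[1,2,1,3,0,0])) (Split {0,3,4} (Leaf ([0,2,3,5],[1,4,1,4,0,0])) (Split {1,2,3} (Leaf
     ([1,2,3,5],[0,2,0,4,0,0])) (Split {1,2,4} (Leaf ([0,1,2,4],[5,5,5,0,2,3])) (Split {1,3,5} (Leaf
     ([0,2,3,5],[1,5,1,4,0,1])) (Leaf ([0,1,2,3,4],[3,4,4,1,3,5,3,0,1,5])))))))))) (Split {1,2,3}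
     (Split {0,1,3} (Leaf ([0,1,3,5],[2,1,2,2,0,0])) (Split {0,1,4} (Leaf ([0,1,2,5],[4,1,3,3,0,0]))
     (Split {0,2,3} (Leaf ([0,1,2,5],[2,3,3,3,0,0])) (Split {0,2,4} (Leaf ([0,1,2,5],[2,4,3,3,0,0]))
     (Split {0,3,4} (Leaf ([0,2,3,5],[1,4,1,1,0,0])) (Split {1,2,5} (Leaf ([0,1,2,5],[5,1,3,3,2,0]))
     (Split {1,3,5} (Leaf ([0,1,2,5],[5,1,3,3,3,0])) (Leaf
     ([0,1,2,3,4],[3,4,4,1,5,5,3,0,3,5]))))))))) (Split {1,4,5} (Split {0,1,4} (Leaf
     ([0,1,4,5],[2,1,2,5,0,0])) (Split {0,2,3} (Leaf ([0,1,2,5],[5,3,3,0,4,0])) (Split {0,2,4} (Leaf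
     ([0,2,4,5],[1,5,1,0,0,1])) (Split {0,3,4} (Leaf ([0,1,4,5],[2,3,2,5,0,0])) (Split {1,2,4} (Leaf
     ([0,1,4,5],[2,5,2,2,0,1])) (Split {1,2,5} (Leaf ([0,1,2,5],[5,1,3,5,4,0])) (Leaf
     ([0,1,2,3,4],[4,3,4,2,5,4,2,1,3,5])))))))) (Split {0,3,4} (Split {0,1,3} (Leaf
     ([0,1,3,5],[2,4,2,0,0,0])) (Split {0,1,4} (Leaf ([0,1,4,5],[2,3,2,0,0,0])) (Split {0,2,3} (Leaf
     ([0,2,3,5],[1,4,1,0,0,0])) (Split {0,2,4} (Leaf ([0,2,4,5],[1,3,1,0,0,0])) (Split {1,2,4} (Leaf
     ([0,2,4,5],[1,3,1,1,0,0])) (Leaf ([0,1,2,3,4],[3,4,2,1,4,4,5,1,3,5]))))))) (Split {0,2,3}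
     (Split {0,1,3} (Leaf ([0,1,2,5],[3,3,3,0,0,0])) (Split {1,2,4} (Leaf ([0,1,2,5],[2,3,3,4,0,0]))
     (Split {1,2,5} (Leaf ([0,1,2,5],[2,3,3,5,0,0])) (Split {1,3,5} (Leaf ([0,1,3,5],[2,2,2,5,0,0]))
     (Leaf ([1,2,3,4,5],[4,0,3,3,1,3,1,0,4,1])))))) (Split {0,1,3} (Split {1,2,4} (Leaf
     ([0,1,2,5],[3,1,3,4,0,0])) (Split {1,2,5} (Leaf ([0,1,2,5],[3,1,3,5,0,0])) (Split {1,3,5} (Leaf
     ([0,1,3,5],[2,1,2,5,0,0])) (Leaf ([1,2,3,4,5],[4,2,3,3,0,3,1,0,4,1]))))) (Split {2,4,5} (Split
     {0,1,4} (Leaf ([0,1,4,5],[2,5,2,0,0,2])) (Split {0,2,4} (Leaf ([0,2,4,5],[1,2,1,5,0,0])) (Leaf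
     ([0,1,2,3,4],[4,4,1,3,3,4,5,0,3,5])))) (Split {0,1,4} (Split {0,2,4} (Leaf
     ([1,2,4,5],[0,0,0,0,0,0])) (Leaf ([0,1,2,3,4],[3,4,2,3,3,4,5,4,5,5]))) (Leaf
     ([0,1,2,3,4],[4,3,1,3,3,4,5,4,5,5]))))))))))) (Split {2,4,5} (Split {1,3,5} (Split {0,1,4}
     (Leaf ([0,1,4,5],[5,5,2,0,3,2])) (Split {0,2,3} (Leaf ([0,2,3,5],[5,5,1,0,4,1])) (Split {0,3,4}
     (Leaf ([0,3,4,5],[5,5,1,0,1,2])) (Split {1,2,3} (Leaf ([0,2,3,5],[5,5,1,1,4,1])) (Split {1,2,4}
     (Leaf ([0,1,2,5],[5,5,3,4,3,4])) (Split {1,2,5} (Leaf ([0,1,2,5],[5,5,3,5,3,4])) (Split {1,3,4}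
     (Leaf ([0,1,4,5],[5,5,2,3,3,2])) (Split {1,4,5} (Leaf ([0,1,4,5],[5,5,2,5,3,2])) (Leaf
     ([0,1,2,3,4],[2,3,4,1,5,4,5,1,1,5])))))))))) (Split {1,2,3} (Split {0,1,3} (Leaf
     ([0,1,2,5],[3,5,3,3,0,4])) (Split {0,1,4} (Leaf ([0,1,2,4],[5,5,5,3,0,5])) (Split {0,2,3} (Leaf
     ([0,2,3,5],[5,2,1,1,4,0])) (Split {0,3,4} (Leaf ([0,2,3,5],[5,4,1,1,4,0])) (Split {1,2,4} (Leaf
     ([1,2,4,5],[3,2,0,5,0,0])) (Split {1,2,5} (Leaf ([0,1,2,5],[5,5,3,3,2,4])) (Split {1,3,4} (Leaf
     ([2,3,4,5],[1,5,0,1,0,0])) (Leaf ([0,1,2,3,4],[3,1,4,1,5,5,3,0,1,5]))))))))) (Split {1,2,5}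
     (Split {0,1,3} (Leaf ([0,1,2,5],[3,5,3,5,0,4])) (Split {0,1,4} (Leaf ([1,2,4,5],[5,0,0,5,0,0]))
     (Split {0,2,4} (Leaf ([0,2,4,5],[5,2,1,5,1,0])) (Split {0,3,4} (Leaf ([0,2,4,5],[5,3,1,5,1,0]))
     (Split {1,2,4} (Leaf ([0,1,2,4],[5,5,5,5,2,5])) (Split {1,3,4} (Leaf ([0,1,4,5],[5,5,2,3,2,2]))
     (Leaf ([0,1,2,3,4],[4,4,1,3,0,5,3,1,1,5])))))))) (Split {1,3,4} (Split {0,1,3} (Leaf
     ([0,1,4,5],[3,5,2,3,0,2])) (Split {0,1,4} (Leaf ([0,1,4,5],[4,5,2,3,0,2])) (Split {0,2,3} (Leaf
     ([2,3,4,5],[0,5,0,1,0,0])) (Split {0,3,4} (Leaf ([0,3,4,5],[4,5,1,1,0,2])) (Split {1,2,4} (Leaf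
     ([0,1,2,4],[5,5,5,4,3,5])) (Leaf ([0,1,2,3,4],[2,3,1,3,5,5,0,1,1,5]))))))) (Split {1,2,4}
     (Split {0,1,3} (Leaf ([0,1,2,5],[3,5,3,4,0,4])) (Split {0,1,4} (Leaf ([0,2,4,5],[5,1,1,1,4,0]))
     (Split {0,2,3} (Leaf ([0,2,4,5],[3,5,1,1,0,2])) (Split {0,2,4} (Leaf ([0,2,4,5],[4,5,1,1,0,2]))
     (Leaf ([0,1,2,3,4],[2,3,1,1,5,5,3,1,0,5])))))) (Split {0,2,3} (Split {0,1,3} (Leaf
     ([0,2,3,5],[5,1,1,0,4,0])) (Split {0,1,4} (Leaf ([0,2,4,5],[3,1,1,5,0,0])) (Split {0,2,4} (Leaf
     ([0,2,4,5],[3,2,1,5,0,0])) (Leaf ([0,1,2,3,4],[2,4,1,1,5,5,3,1,1,5]))))) (Split {0,3,4} (Split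
     {0,1,3} (Leaf ([0,3,4,5],[1,5,1,0,0,2])) (Split {0,2,4} (Leaf ([0,2,4,5],[4,3,1,5,0,0])) (Leaf
     ([0,1,2,3,4],[3,1,2,2,5,5,3,1,1,5])))) (Split {0,1,3} (Split {0,1,4} (Leaf
     ([0,1,4,5],[3,5,2,0,0,2])) (Leaf ([0,1,2,3,4],[4,1,2,3,5,5,3,1,1,5]))) (Leaf
     ([0,1,2,3,4],[3,1,2,3,5,5,3,1,1,5])))))))))) (Split {1,2,4} (Split {1,2,3} (Split {0,1,3} (Leaf
     ([0,1,2,3],[5,5,5,4,0,1])) (Split {0,1,4} (Leaf ([1,2,4,5],[3,0,0,1,0,0])) (Split {0,2,3} (Leaf
     ([1,2,3,5],[4,2,0,0,0,0])) (Split {0,2,4} (Leaf ([1,2,4,5],[3,2,0,0,0,0])) (Split {0,3,4} (Leaf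
     ([0,1,3,4],[5,5,5,2,2,0])) (Split {1,3,4} (Leaf ([2,3,4,5],[1,1,0,1,0,0])) (Split {1,3,5} (Leaf
     ([1,2,3,5],[4,5,0,1,0,0])) (Leaf ([0,1,2,3,4],[3,4,4,1,0,5,3,0,5,5]))))))))) (Split {0,3,4}
     (Split {0,1,3} (Leaf ([1,3,4,5],[0,2,0,0,0,0])) (Split {0,1,4} (Leaf ([0,1,4,5],[4,3,2,2,0,0]))
     (Split {0,2,3} (Leaf ([0,2,3,4],[5,5,5,0,1,0])) (Split {0,2,4} (Leaf ([0,2,4,5],[4,3,1,1,0,0]))
     (Split {1,2,5} (Leaf ([0,1,4,5],[5,3,2,2,2,0])) (Split {1,3,4} (Leaf ([1,3,4,5],[4,2,0,0,0,0]))
     (Leaf ([0,1,2,3,4],[2,3,1,2,5,4,0,1,5,5])))))))) (Split {2,3,4} (Split {0,1,3} (Leaf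
     ([0,1,3,4],[5,5,5,0,2,2])) (Split {0,1,4} (Leaf ([0,1,2,4],[5,5,5,4,0,3])) (Split {0,2,3} (Leaf
     ([2,3,4,5],[0,1,0,2,0,0])) (Split {1,2,5} (Leaf ([0,1,2,4],[5,5,5,5,2,3])) (Split {1,3,4} (Leaf
     ([0,2,3,4],[5,5,5,4,1,1])) (Leaf ([0,1,2,3,4],[3,1,2,3,5,4,0,1,5,5]))))))) (Split {0,2,3}
     (Split {0,1,3} (Leaf ([1,2,3,5],[4,0,0,0,0,0])) (Split {0,1,4} (Leaf ([0,1,2,5],[4,3,3,4,0,0]))
     (Split {0,2,4} (Leaf ([0,2,4,5],[3,2,1,1,0,0])) (Split {1,2,5} (Leaf ([0,1,2,5],[5,3,3,4,2,0]))
     (Leaf ([0,1,2,3,4],[3,1,4,2,5,2,0,4,5,5])))))) (Split {0,1,4} (Split {0,1,3} (Leaf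
     ([0,1,4,5],[3,1,2,2,0,0])) (Split {0,2,4} (Leaf ([0,1,4,5],[4,2,2,2,0,0])) (Split {1,4,5} (Leaf
     ([0,1,4,5],[5,1,2,2,4,0])) (Leaf ([0,1,2,3,4],[2,4,2,3,3,0,5,4,5,5]))))) (Split {1,3,5} (Split
     {0,2,4} (Leaf ([0,1,2,5],[5,4,3,4,3,0])) (Split {1,2,5} (Leaf ([0,1,2,5],[5,5,3,4,3,1])) (Leaf
     ([0,1,2,3,4],[2,4,2,3,5,2,0,4,5,5])))) (Split {0,1,3} (Split {0,2,4} (Leaf
     ([0,1,2,5],[3,4,3,4,0,0])) (Leaf ([0,1,2,3,4],[2,4,2,3,3,5,0,4,5,5]))) (Leaf
     ([0,1,2,3,4],[3,1,2,3,3,5,0,4,5,5]))))))))) (Split {0,1,4} (Split {2,3,4} (Split {0,1,3} (Leaf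
     ([1,3,4,5],[0,0,0,2,0,0])) (Split {0,2,3} (Leaf ([0,2,4,5],[3,1,1,3,0,0])) (Split {0,2,4} (Leaf
     ([0,2,4,5],[4,1,1,3,0,0])) (Split {0,3,4} (Leaf ([0,3,4,5],[4,1,1,2,0,0])) (Split {1,2,3} (Leaf
     ([1,3,4,5],[2,0,0,2,0,0])) (Split {1,2,5} (Leaf ([0,1,2,4],[5,5,5,5,0,3])) (Leaf
     ([0,1,2,3,4],[2,4,1,3,5,2,2,0,5,5])))))))) (Split {1,2,3} (Split {0,1,3} (Leaf
     ([0,1,3,5],[4,1,2,2,0,0])) (Split {0,2,3} (Leaf ([0,1,3,5],[4,2,2,2,0,0])) (Split {0,2,4} (Leaf
     ([0,1,2,4],[5,5,5,3,0,0])) (Split {0,3,4} (Leaf ([1,3,4,5],[2,0,0,0,0,0])) (Split {1,2,5} (Leaf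
     ([0,1,2,5],[4,5,3,3,0,1])) (Leaf ([0,1,2,3,4],[2,3,4,2,5,0,2,4,5,5]))))))) (Split {0,1,3}
     (Split {0,2,3} (Leaf ([0,1,3,5],[4,2,2,0,0,0])) (Split {0,2,4} (Leaf ([0,1,4,5],[3,2,2,0,0,0]))
     (Split {0,3,4} (Leaf ([0,1,4,5],[3,3,2,0,0,0])) (Split {1,3,4} (Leaf ([0,1,4,5],[3,1,2,3,0,0]))
     (Leaf ([0,1,2,3,4],[2,3,4,2,3,4,2,4,5,5])))))) (Split {0,3,4} (Split {1,2,5} (Leaf
     ([0,1,4,5],[5,3,2,0,2,0])) (Split {1,3,4} (Leaf ([1,3,4,5],[4,0,0,0,0,0])) (Split {1,3,5} (Leaf
     ([0,3,4,5],[5,1,1,0,1,0])) (Leaf ([1,2,3,4,5],[0,0,3,3,1,1,1,2,4,2]))))) (Split {1,2,5} (Split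
     {0,2,3} (Leaf ([0,1,2,5],[4,3,3,5,0,0])) (Split {0,2,4} (Leaf ([0,1,2,5],[4,4,3,5,0,0])) (Leaf
     ([0,1,2,3,4],[3,4,2,3,0,2,2,4,5,5])))) (Split {0,2,3} (Split {0,2,4} (Leaf
     ([0,2,4,5],[3,1,1,0,0,0])) (Leaf ([0,1,2,3,4],[2,4,1,3,5,2,2,4,5,5]))) (Leaf
     ([0,1,2,3,4],[2,3,1,3,5,2,2,4,5,5])))))))) (Split {1,3,4} (Split {0,1,3} (Split {0,2,3} (Leaf
     ([0,1,3,5],[3,2,2,4,0,0])) (Split {0,2,4} (Leaf ([0,1,4,5],[3,2,2,3,0,0])) (Split {0,3,4} (Leaf
     ([0,3,4,5],[1,3,1,1,0,0])) (Split {1,2,5} (Leaf ([0,1,3,5],[5,1,2,4,2,0])) (Split {1,3,5} (Leaf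
     ([0,1,3,5],[5,1,2,4,3,0])) (Leaf ([0,1,2,3,4],[2,4,4,1,5,5,2,0,5,5]))))))) (Split {1,2,3}
     (Split {0,2,3} (Leaf ([1,2,3,5],[3,4,0,0,0,0])) (Split {0,2,4} (Leaf ([2,3,4,5],[1,0,0,1,0,0]))
     (Split {0,3,4} (Leaf ([0,1,3,4],[5,5,5,2,3,0])) (Split {1,2,5} (Leaf ([0,1,2,3],[5,5,5,5,4,1]))
     (Leaf ([0,1,2,3,4],[2,4,4,1,5,0,2,0,5,5])))))) (Split {2,3,4} (Split {0,2,3} (Leaf
     ([0,2,3,4],[5,5,5,0,3,1])) (Split {0,2,4} (Leaf ([2,3,4,5],[4,0,0,1,0,0])) (Split {1,2,5} (Leaf
     ([0,1,2,3],[5,5,5,5,4,4])) (Leaf ([0,1,2,3,4],[2,4,1,1,5,2,2,0,5,5]))))) (Split {1,4,5} (Split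
     {0,2,3} (Leaf ([0,3,4,5],[2,5,1,1,0,1])) (Split {0,2,4} (Leaf ([0,1,4,5],[5,2,2,3,4,0])) (Leaf
     ([0,1,2,3,4],[3,4,2,1,0,2,2,4,5,5])))) (Split {0,2,3} (Split {0,2,4} (Leaf
     ([2,3,4,5],[0,0,0,1,0,0])) (Leaf ([0,1,2,3,4],[2,4,1,1,4,2,5,4,5,5]))) (Leaf
     ([0,1,2,3,4],[2,3,1,1,4,2,5,4,5,5]))))))) (Split {1,2,3} (Split {0,3,4} (Split {0,1,3} (Leaf
     ([0,1,3,5],[3,4,2,2,0,0])) (Split {0,2,3} (Leaf ([0,2,3,5],[3,4,1,1,0,0])) (Split {0,2,4} (Leaf
     ([2,3,4,5],[1,0,0,0,0,0])) (Split {1,2,5} (Leaf ([0,2,3,5],[5,4,1,1,1,0])) (Leaf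
     ([0,1,2,3,4],[2,4,1,1,5,4,2,0,5,5])))))) (Split {2,3,4} (Split {0,1,3} (Leaf
     ([0,1,2,3],[5,5,5,3,0,4])) (Split {0,2,4} (Leaf ([2,3,4,5],[1,0,0,2,0,0])) (Split {0,2,3}
     (Split {2,3,5} (Leaf ([0,2,3,5],[5,2,1,1,3,0])) (Leaf ([0,1,2,3,4],[2,4,1,3,4,4,0,5,5,5])))
     (Leaf ([0,1,2,3,4],[2,4,1,3,4,4,0,0,5,5]))))) (Split {1,3,5} (Split {0,1,3} (Leaf
     ([0,1,3,5],[3,5,2,2,0,1])) (Split {0,2,3} (Leaf ([0,1,2,5],[5,3,3,3,3,0])) (Leaf
     ([0,1,2,3,4],[2,3,1,3,4,4,0,4,5,5])))) (Split {0,1,3} (Split {0,2,3} (Leaf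
     ([1,2,3,5],[3,0,0,0,0,0])) (Leaf ([0,1,2,3,4],[2,3,4,1,4,5,3,4,5,5]))) (Leaf
     ([0,1,2,3,4],[3,1,4,1,4,5,3,4,5,5])))))) (Split {1,3,5} (Split {0,3,4} (Split {0,1,3} (Leaf
     ([0,1,3,5],[3,4,2,5,0,0])) (Split {0,2,4} (Leaf ([0,3,4,5],[5,2,1,0,1,0])) (Split {1,2,5} (Leaf
     ([0,1,3,5],[5,4,2,5,2,0])) (Leaf ([0,1,2,3,4],[2,4,1,1,5,4,2,1,5,5]))))) (Split {1,2,5} (Split
     {0,1,3} (Leaf ([0,1,3,5],[5,1,2,5,2,0])) (Split {0,2,3} (Leaf ([0,1,2,3],[5,5,5,5,5,0])) (Leaf
     ([0,1,2,3,4],[2,3,1,3,4,4,0,1,5,5])))) (Split {0,1,3} (Split {0,2,3} (Leaf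
     ([0,1,3,5],[3,2,2,5,0,0])) (Leaf ([0,1,2,3,4],[2,3,4,1,5,4,2,1,5,5]))) (Leaf
     ([0,1,2,3,4],[3,1,4,1,5,4,2,1,5,5]))))) (Split {0,2,3} (Split {0,1,3} (Split {1,2,5} (Leaf
     ([0,1,2,3],[5,5,5,5,0,0])) (Split {1,4,5} (Leaf ([0,1,3,5],[5,2,2,0,4,0])) (Leaf
     ([1,2,3,4,5],[0,5,0,4,1,1,1,1,4,2])))) (Split {0,2,4} (Split {0,3,4} (Leaf
     ([0,3,4,5],[2,2,1,0,0,0])) (Leaf ([0,1,2,3,4],[3,1,4,1,4,5,3,1,5,5]))) (Leaf
     ([0,1,2,3,4],[2,4,1,1,4,5,3,1,5,5])))) (Split {0,1,3} (Split {0,2,4} (Split {0,3,4} (Leaf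
     ([0,3,4,5],[1,2,1,0,0,0])) (Leaf ([0,1,2,3,4],[2,3,4,1,4,5,3,1,5,5]))) (Leaf
     ([0,1,2,3,4],[2,4,2,1,4,5,3,1,5,5]))) (Leaf ([0,1,2,3,4],[3,1,2,1,4,5,3,1,5,5]))))))))))))"
    by code_simp
  from closes_clique_leaf[OF this assms] show ?thesis by simp
qed

text \<open>The other shape of a disconnected second link, with sides \<open>{0, 1}\<close> and
  \<open>{2, 3, 4}\<close>. Six hyperedges of the first colour are given, which keeps the tree
  short.\<close>

lemma first_bipartite_arrows:
  fixes c :: "nat set \<Rightarrow> colour"
  assumes "\<forall>e \<in> set [{5,0,2},{5,0,3},{5,0,4},{5,1,2},{5,1,3},{5,1,4}]. c e = First"
  shows "has_clique c First {..<6} 4 \<or> has_clique c Second {..<6} 5"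
proof -
  have "closes (clique_leaf 6 4 5) [{5,0,2},{5,0,3},{5,0,4},{5,1,2},{5,1,3},{5,1,4}] []
    (Split {0,2,3} (Leaf ([0,2,3,5],[5,5,4,0,1,1])) (Split {0,2,4} (Leaf ([0,2,4,5],[5,5,3,0,1,1]))
     (Split {0,3,4} (Leaf ([1,3,4,5],[5,5,2,0,0,0])) (Split {1,2,3} (Leaf ([0,2,3,5],[5,5,4,1,1,1]))
     (Split {1,2,4} (Leaf ([0,2,4,5],[5,5,3,1,1,1])) (Split {1,3,4} (Leaf ([0,3,4,5],[5,5,2,1,1,1]))
     (Split {2,3,4} (Leaf ([1,3,4,5],[5,5,2,2,0,0])) (Split {2,3,5} (Leaf ([0,2,3,5],[5,5,4,5,1,1]))
     (Split {2,4,5} (Leaf ([1,2,4,5],[5,5,3,5,0,0])) (Split {0,1,2} (Split {0,1,3} (Leaf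
     ([0,1,3,5],[2,1,2,5,2,0])) (Leaf ([0,1,2,3,4],[3,3,4,2,3,4,2,5,5,2]))) (Leaf
     ([0,1,2,3,4],[2,3,4,2,3,4,2,5,5,2]))))))))))))"
    by code_simp
  from closes_clique_leaf[OF this assms] show ?thesis by simp
qed

text \<open>Now it is the first link of \<open>5\<close> that is cut. The conclusion is weaker than
  a clique of full size, so the tree stays small; \<open>arrows_6_4_5\<close> turns both outcomes
  into cliques when all second links are connected.\<close>

lemma second_star_link:
  fixes c :: "nat set \<Rightarrow> colour"
  assumes "\<forall>e \<in> set [{5,0,1},{5,0,2},{5,0,3},{5,0,4}]. c e = Second"
  shows "\<exists>v < 6. link_connected c First {..<6} v \<or> has_clique c Second ({..<6} - {v}) 4"
proof -
  have "closes link_leaf [] [{5,0,1},{5,0,2},{5,0,3},{5,0,4}]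
    (Split {1,3,5} (Split {3,4,5} (Split {2,3,5} (Split {0,1,3} (Leaf ([3],[])) (Split {0,2,3} (Leaf
     ([3],[])) (Split {0,1,2} (Split {0,3,4} (Leaf ([3],[])) (Split {0,1,4} (Split {1,2,3} (Leaf
     ([1],[])) (Leaf ([0,1,2,3],[5,5,5,3,0,0]))) (Leaf ([0,1,4,5],[3,3,3,0,0,0])))) (Leaf
     ([0,2,3,5],[1,1,1,0,0,0]))))) (Split {0,1,3} (Split {0,2,3} (Leaf ([3],[])) (Split {1,2,3}
     (Leaf ([3],[])) (Leaf ([0,2,3,5],[5,2,1,1,3,0])))) (Split {0,2,3} (Split {1,2,3} (Leaf
     ([3],[])) (Leaf ([0,1,3,5],[3,5,2,2,0,2]))) (Leaf ([0,2,3,5],[3,1,1,5,0,0]))))) (Split {0,2,3}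
     (Split {0,1,3} (Split {0,3,4} (Leaf ([3],[])) (Split {1,3,4} (Leaf ([3],[])) (Leaf
     ([0,3,4,5],[5,3,1,1,4,0])))) (Split {0,3,4} (Split {1,3,4} (Leaf ([3],[])) (Leaf
     ([0,1,3,4],[5,5,5,0,3,5]))) (Leaf ([0,3,4,5],[1,3,1,5,0,0])))) (Split {0,3,4} (Split {2,3,4}
     (Split {2,3,5} (Leaf ([3],[])) (Leaf ([0,2,3,5],[3,5,4,5,0,4]))) (Leaf
     ([0,3,4,5],[2,5,2,2,0,3]))) (Leaf ([0,3,4,5],[2,3,2,5,0,0]))))) (Split {1,4,5} (Split {1,2,5}
     (Split {0,1,2} (Split {0,1,3} (Leaf ([1],[])) (Split {1,2,3} (Leaf ([1],[])) (Leaf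
     ([0,1,3,5],[5,1,2,2,3,0])))) (Split {0,1,3} (Split {1,2,3} (Leaf ([1],[])) (Leaf
     ([0,1,2,3],[5,5,5,0,5,1]))) (Leaf ([0,1,3,5],[2,1,2,5,0,0])))) (Split {0,1,2} (Split {0,1,3}
     (Split {0,1,4} (Leaf ([1],[])) (Split {1,2,4} (Leaf ([1],[])) (Leaf
     ([0,1,2,5],[4,5,4,4,0,1])))) (Leaf ([0,1,3,5],[5,1,2,5,2,0]))) (Leaf
     ([0,1,2,5],[5,1,3,5,3,0])))) (Split {0,1,3} (Split {0,3,4} (Split {3,4,5} (Split {0,2,3} (Leaf
     ([3],[])) (Split {1,2,3} (Leaf ([3],[])) (Leaf ([0,2,3,5],[3,5,1,1,0,1])))) (Leaf
     ([0,1,3,5],[5,5,4,5,4,4]))) (Leaf ([0,1,4,5],[5,3,3,5,3,0]))) (Leaf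
     ([0,1,3,5],[5,1,4,5,4,0])))))"
    by code_simp
  from closes_link_leaf[OF this _ assms] show ?thesis by simp
qed

text \<open>The counterpart of \<open>second_star_link\<close> for a cut with sides of two and three
  vertices.\<close>

lemma second_bipartite_link:
  fixes c :: "nat set \<Rightarrow> colour"
  assumes "\<forall>e \<in> set [{5,0,2},{5,0,3},{5,0,4},{5,1,2},{5,1,3},{5,1,4}]. c e = Second"
  shows "\<exists>v < 6. link_connected c First {..<6} v \<or> has_clique c Second ({..<6} - {v}) 4"
proof -
  have "closes link_leaf [] [{5,0,2},{5,0,3},{5,0,4},{5,1,2},{5,1,3},{5,1,4}]
    (Split {0,1,5} (Split {0,1,2} (Split {0,1,3} (Split {0,1,4} (Leaf ([0],[])) (Split {0,2,4} (Leaf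
     ([0],[])) (Leaf ([0,1,4,5],[4,2,2,5,2,0])))) (Split {0,1,4} (Split {0,2,3} (Leaf ([0],[]))
     (Leaf ([0,2,3,5],[5,1,3,0,1,1]))) (Leaf ([0,1,3,5],[4,1,4,5,4,0])))) (Split {0,1,3} (Split
     {0,1,4} (Split {0,2,3} (Leaf ([0],[])) (Leaf ([0,1,2,5],[2,3,3,5,3,0]))) (Leaf
     ([0,1,2,5],[4,1,4,5,4,0]))) (Leaf ([0,1,2,5],[3,1,3,5,3,0])))) (Split {0,1,2} (Split {0,2,3}
     (Split {0,2,4} (Split {2,3,5} (Leaf ([2],[])) (Leaf ([0,1,3,5],[5,5,2,5,2,2]))) (Leaf
     ([0,2,4,5],[5,5,1,0,1,1]))) (Leaf ([1,2,3,5],[5,5,0,0,0,0]))) (Leaf ([0,1,2,5],[5,1,4,5,4,0]))))"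
    by code_simp
  from closes_link_leaf[OF this _ assms] show ?thesis by simp
qed

text \<open>A disconnected second link is settled by the two searches for the first colour.
  Otherwise every second link is connected, so a second-coloured \<open>K_4\<close> that misses a
  vertex extends to \<open>K_5\<close>. It then suffices to find a vertex whose first link is
  connected too, or which such a \<open>K_4\<close> misses.\<close>

lemma arrows_6_4_5: "arrows 6 4 5"
  unfolding arrows_def
proof
  fix c :: "nat set \<Rightarrow> colour"
  let ?V = "{..<6::nat}"
  have card6: "card ?V = 6" and five: "5 \<in> ?V" by simp_all
  show "has_clique c First ?V 4 \<or> has_clique c Second ?V 5"
  proof (cases "\<exists>x \<in> ?V. \<not> link_connected c Second ?V x")
    case True
    then obtain x where x: "x \<in> ?V" "\<not> link_connected c Second ?V x" by blast
    obtain h :: "nat \<Rightarrow> nat" where h: "inj_on h {..<6}" "h ` {..<6} = ?V"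
      "(\<forall>e \<in> set [{5,0,1},{5,0,2},{5,0,3},{5,0,4}]. c (h ` e) = First) \<or>
       (\<forall>e \<in> set [{5,0,2},{5,0,3},{5,0,4},{5,1,2},{5,1,3},{5,1,4}]. c (h ` e) = First)"
      by (rule not_link_connected_normal_form[OF card6 x colour.distinct(1)])
    have "has_clique (\<lambda>e. c (h ` e)) First {..<6} 4 \<or> has_clique (\<lambda>e. c (h ` e)) Second {..<6} 5"
      using h(3) first_star_arrows[of "\<lambda>e. c (h ` e)"] first_bipartite_arrows[of "\<lambda>e. c (h ` e)"] by blast
    then show ?thesis using has_clique_image[OF h(1), of c] h(2) by metis
  next
    case False
    then have conn2: "link_connected c Second ?V v" if "v \<in> ?V" for v using that by blast
    \<comment> \<open>If the first link of \<open>5\<close> is connected, \<open>5\<close> will do;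
      otherwise its cut is relabelled to a normal form and searched.\<close>
    have "\<exists>v \<in> ?V. link_connected c First ?V v \<or> has_clique c Second (?V - {v}) 4"
    proof (cases "link_connected c First ?V 5")
      case False
      obtain h :: "nat \<Rightarrow> nat" where h: "inj_on h {..<6}" "h ` {..<6} = ?V"
        "(\<forall>e \<in> set [{5,0,1},{5,0,2},{5,0,3},{5,0,4}]. c (h ` e) = Second) \<or>
         (\<forall>e \<in> set [{5,0,2},{5,0,3},{5,0,4},{5,1,2},{5,1,3},{5,1,4}]. c (h ` e) = Second)"
        by (rule not_link_connected_normal_form[OF card6 five False colour.distinct(2)])
      obtain v where v: "v < 6" "link_connected (\<lambda>e. c (h ` e)) First {..<6} v \<or>
          has_clique (\<lambda>e. c (h ` e)) Second ({..<6} - {v}) 4"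
        using h(3) second_star_link[of "\<lambda>e. c (h ` e)"] second_bipartite_link[of "\<lambda>e. c (h ` e)"] by blast
      have "h ` ({..<6} - {v}) = ?V - {h v}"
        using inj_on_image_set_diff[OF h(1), of "{..<6}" "{v}"] h(2) v(1) by auto
      moreover have "inj_on h ({..<6} - {v})" using h(1) by (rule inj_on_subset) auto
      ultimately have "link_connected c First ?V (h v) \<or> has_clique c Second (?V - {h v}) 4"
        using v(2) link_connected_image[OF h(1), of v c First] has_clique_image[of h "{..<6} - {v}" c Second 4] h(2) v(1)
        by (metis lessThan_iff)
      moreover have "h v \<in> ?V" using h(2) v(1) by blast
      ultimately show ?thesis by blast
    qed auto
    then obtain v where v: "v \<in> ?V" "link_connected c First ?V v \<or> has_clique c Second (?V - {v}) 4" by blast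
    \<comment> \<open>Apply \<open>(3, 4)\<close> to the five vertices other than \<open>v\<close>;
      whichever clique appears is extended by \<open>v\<close> through a connected link of its
      colour.\<close>
    have "has_clique c First (?V - {v}) 3 \<or> has_clique c Second (?V - {v}) 4"
      using arrowsD[OF arrows_5_3_4, of "?V - {v}" c] v(1) by simp
    then have "link_connected c First ?V v \<and> has_clique c First (?V - {v}) 3 \<or> has_clique c Second (?V - {v}) 4"
      using v(2) by blast
    then show ?thesis
      using has_clique_Suc[of ?V v c First 3] has_clique_Suc[of ?V v c Second 4] conn2[OF v(1)] v(1) by auto
  qed
qed

section \<open>Upper bounds\<close>

lemma arrows_mono:
  assumes "arrows n s t" "n \<le> n'" "s' \<le> s" "t' \<le> t"
  shows "arrows n' s' t'"
proof -
  have "{..<n} \<subseteq> {..<n'}" using assms(2) by auto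
  then show ?thesis using assms(1,3,4) has_clique_mono unfolding arrows_def by metis
qed

lemma arrows_commute:
  assumes "arrows n s t"
  shows "arrows n t s"
  unfolding arrows_def
proof
  fix c :: "nat set \<Rightarrow> colour"
  define c' where "c' = (\<lambda>e. if c e = First then Second else First)"
  have "c' e = First \<longleftrightarrow> c e = Second" "c' e = Second \<longleftrightarrow> c e = First" for e
    unfolding c'_def by (cases "c e"; simp)+
  then show "has_clique c First {..<n} t \<or> has_clique c Second {..<n} s"
    using assms has_clique_cong[of c' First c Second] has_clique_cong[of c' Second c First]
    unfolding arrows_def by blast
qed

text \<open>The last vertex has a connected link in one colour. On the other \<open>n\<close>
  vertices the target of that colour is lowered by one, and a clique found there grows by the last
  vertex. The bounds \<open>s < n\<close> and \<open>t < n\<close> provide the spare root for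
  \<open>has_clique_Suc\<close>.\<close>

lemma arrows_Suc:
  assumes "arrows n s (Suc t)" "arrows n (Suc s) t" "s < n" "t < n"
  shows "arrows (Suc n) (Suc s) (Suc t)"
  unfolding arrows_def
proof
  fix c :: "nat set \<Rightarrow> colour"
  let ?V = "{..<Suc n}"
  have n: "n \<in> ?V" "?V - {n} = {..<n}" by auto
  have up: "has_clique c i ?V k" if "has_clique c i {..<n} k" for i k
    by (rule has_clique_mono[OF that]) auto
  from link_connected_cases[of c ?V n]
  show "has_clique c First ?V (Suc s) \<or> has_clique c Second ?V (Suc t)"
  proof
    assume "link_connected c First ?V n"
    then show ?thesis
      using assms(1,3) up has_clique_Suc[of ?V n c First s] n unfolding arrows_def by auto
  next
    assume "link_connected c Second ?V n"
    then show ?thesis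
      using assms(2,4) up has_clique_Suc[of ?V n c Second t] n unfolding arrows_def by auto
  qed
qed

section \<open>Triangles from disconnected links\<close>

lemma has_clique_3I:
  assumes "a \<noteq> b" "a \<noteq> d" "b \<noteq> d" "{a, b} \<subseteq> T1" "{a, d} \<subseteq> T2" "{b, d} \<subseteq> T3"
    and "T1 \<noteq> T2" "T1 \<noteq> T3" "T2 \<noteq> T3" "\<forall>T \<in> {T1, T2, T3}. T \<in> [V]\<^bsup>3\<^esup> \<and> c T = i"
  shows "has_clique c i V 3"
proof -
  define f where "f = (\<lambda>p. if p = {a, b} then T1 else if p = {a, d} then T2 else T3)"
  have ne: "{a, b} \<noteq> {a, d}" "{a, b} \<noteq> {b, d}" "{a, d} \<noteq> {b, d}"
    using assms(1-3) by (auto simp: doubleton_eq_iff)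
  have pairs3: "p = {a, b} \<or> p = {a, d} \<or> p = {b, d}" if "p \<in> [{a, b, d}]\<^bsup>2\<^esup>" for p
  proof -
    have "card p = 2" "p \<subseteq> {a, b, d}" using that by (simp_all add: nsets_def)
    then obtain u v where "p = {u, v}" "u \<noteq> v" "u \<in> {a, b, d}" "v \<in> {a, b, d}"
      by (auto simp: card_2_iff)
    then show ?thesis by auto
  qed
  have f: "f {a, b} = T1" "f {a, d} = T2" "f {b, d} = T3" using ne by (auto simp: f_def)
  have "inj_on f ([{a, b, d}]\<^bsup>2\<^esup>)"
  proof (rule inj_onI)
    fix p q assume pq: "p \<in> [{a, b, d}]\<^bsup>2\<^esup>" "q \<in> [{a, b, d}]\<^bsup>2\<^esup>" "f p = f q"
    show "p = q"
      using pairs3[OF pq(1)] pairs3[OF pq(2)] pq(3)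
      by (elim disjE) (use f assms(7-9) in simp_all)
  qed
  moreover have "\<forall>p \<in> [{a, b, d}]\<^bsup>2\<^esup>. p \<subseteq> f p \<and> f p \<in> [V]\<^bsup>3\<^esup> \<and> c (f p) = i"
  proof
    fix p assume "p \<in> [{a, b, d}]\<^bsup>2\<^esup>"
    from pairs3[OF this] show "p \<subseteq> f p \<and> f p \<in> [V]\<^bsup>3\<^esup> \<and> c (f p) = i"
      by (elim disjE) (use f assms(4-6,10) in simp_all)
  qed
  moreover have "{a, b, d} \<subseteq> V" using assms(4-6,10) by (auto simp: nsets_def)
  moreover have "finite {a, b, d}" "card {a, b, d} = 3" using assms(1-3) by auto
  ultimately show ?thesis unfolding has_clique_def berge_clique_def by blast
qed

lemma nsets_3I: "a \<noteq> b \<Longrightarrow> a \<noteq> d \<Longrightarrow> b \<noteq> d \<Longrightarrow> a \<in> V \<Longrightarrow> b \<in> V \<Longrightarrow> d \<in> V \<Longrightarrow> {a, b, d} \<in> [V]\<^bsup>3\<^esup>"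
  by (auto simp: nsets_def)

text \<open>A cut of the second link of \<open>y\<close> makes its first link contain a complete
  bipartite graph. If both sides have two vertices, three of its edges host a triangle through
  \<open>y\<close>; otherwise it is a star, and the cut at one further vertex supplies the third
  host. Only five vertices are ever involved, so a sixth is missed, as \<open>has_clique_Suc\<close>
  requires.\<close>

lemma has_clique_3_of_cuts:
  assumes fin: "finite V" and card: "card V \<ge> 6"
    and cut: "\<forall>x \<in> V. \<not> link_connected c Second V x"
  shows "\<exists>x \<in> V. has_clique c First (V - {x}) 3"
proof -
  have fresh: "\<exists>x \<in> V. x \<notin> U" if "finite U" "card U \<le> 5" for U
  proof (rule ccontr)
    assume "\<not> ?thesis"
    then have "card V \<le> card U" using that(1) by (intro card_mono) auto
    then show False using that(2) card by linarith
  qed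
  have cutE: "\<exists>C D. C \<noteq> {} \<and> D \<noteq> {} \<and> C \<inter> D = {} \<and> C \<union> D = V - {x} \<and>
      (\<forall>a \<in> C. \<forall>b \<in> D. c {x, a, b} = First)" if "x \<in> V" for x
  proof -
    have "\<not> link_connected c Second V x" using cut that by blast
    then obtain C where "C \<subset> V - {x}" "C \<noteq> {}" "\<forall>a \<in> C. \<forall>b \<in> V - {x} - C. c {x, a, b} \<noteq> Second"
      unfolding link_connected_def by metis
    moreover have "c e = First" if "c e \<noteq> Second" for e using that by (cases "c e") auto
    ultimately show ?thesis by (intro exI[of _ C] exI[of _ "V - {x} - C"]) auto
  qed
  \<comment> \<open>It is enough to find the triangle, hosts included, on at most five
    vertices.\<close>
  have clique: "\<exists>x \<in> V. has_clique c First (V - {x}) 3"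
    if U: "U \<subseteq> V" "finite U" "card U \<le> 5" "has_clique c First U 3" for U
  proof -
    obtain x where "x \<in> V" "x \<notin> U" using fresh[OF U(2,3)] by blast
    moreover have "has_clique c First (V - {x}) 3"
      by (rule has_clique_mono[OF U(4)]) (use U(1) calculation in auto)
    ultimately show ?thesis by blast
  qed
  \<comment> \<open>The star case: every hyperedge through the pair \<open>u\<close>,
    \<open>v\<close> has the first colour.\<close>
  have star: "\<exists>x \<in> V. has_clique c First (V - {x}) 3"
    if u: "u \<in> V" "v \<in> V" "u \<noteq> v" and full: "\<forall>w \<in> V - {u, v}. c {u, v, w} = First" for u v
  proof -
    have fV: "\<exists>x \<in> V. x \<notin> set xs" if "length xs \<le> 5" for xs
      by (rule fresh) (use card_length[of xs] that in simp_all)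
    obtain d where d: "d \<in> V" "d \<notin> set [u, v]" using fV[of "[u, v]"] by auto
    obtain d' where d': "d' \<in> V" "d' \<notin> set [u, v, d]" using fV[of "[u, v, d]"] by auto
    obtain C D where CD: "C \<noteq> {}" "D \<noteq> {}" "C \<union> D = V - {d}" "C \<inter> D = {}" "\<forall>a \<in> C. \<forall>b \<in> D. c {d, a, b} = First"
      using cutE[OF d(1)] by metis
    \<comment> \<open>In a complete bipartite graph with nonempty sides every vertex has a
      neighbour; here \<open>z\<close> is one of \<open>d'\<close> in the first link of
      \<open>d\<close>.\<close>
    have "\<exists>z \<in> V - {d, d'}. c {d, d', z} = First"
    proof (cases "d' \<in> C")
      case True
      then obtain z where "z \<in> D" using CD by blast
      then show ?thesis using True CD by (intro bexI[of _ z]) auto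
    next
      case False
      then have "d' \<in> D" using CD d d' by auto
      moreover obtain z where z: "z \<in> C" using CD by blast
      ultimately have "c {d, z, d'} = First" using CD by blast
      then have "c {d, d', z} = First" by (simp add: insert_commute)
      then show ?thesis using z False CD by (intro bexI[of _ z]) auto
    qed
    then obtain z where z: "z \<in> V" "z \<noteq> d" "z \<noteq> d'" "c {d, d', z} = First" by auto
    obtain w where w: "w \<in> V" "w \<notin> set [u, v, d, d']" using fV[of "[u, v, d, d']"] by auto
    have dist: "u \<noteq> v" "d \<noteq> u" "d \<noteq> v" "d' \<noteq> u" "d' \<noteq> v" "d' \<noteq> d" "w \<noteq> u" "w \<noteq> v" "w \<noteq> d" "w \<noteq> d'"
      using u d d' w by auto
    have col: "c {u, v, d} = First" "c {u, v, d'} = First" "c {u, v, w} = First"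
      using full d d' w by auto
    \<comment> \<open>If \<open>z\<close> is \<open>u\<close> or \<open>v\<close>, the triangle is
      on \<open>u\<close>, \<open>v\<close>, \<open>d\<close>, with \<open>{u, v, w}\<close> as an
      extra host; otherwise it is on \<open>d\<close>, \<open>d'\<close>, \<open>u\<close>.\<close>
    consider "z = u" | "z = v" | "z \<noteq> u" "z \<noteq> v" by blast
    then show ?thesis
    proof cases
      case 1
      have "has_clique c First {u, v, d, d', w} 3"
        by (rule has_clique_3I[of u v d "{u, v, w}" "{d, d', u}" "{u, v, d}"])
          (use dist col z 1 in \<open>auto intro!: nsets_3I\<close>)
      then show ?thesis by (intro clique[of "{u, v, d, d', w}"]) (use u d d' w dist in auto)
    next
      case 2
      have "has_clique c First {u, v, d, d', w} 3"
        by (rule has_clique_3I[of u v d "{u, v, w}" "{u, v, d}" "{d, d', v}"])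
          (use dist col z 2 in \<open>auto intro!: nsets_3I\<close>)
      then show ?thesis by (intro clique[of "{u, v, d, d', w}"]) (use u d d' w dist in auto)
    next
      case 3
      have "has_clique c First {u, v, d, d', z} 3"
        by (rule has_clique_3I[of d d' u "{d, d', z}" "{u, v, d}" "{u, v, d'}"])
          (use dist col z 3 in \<open>auto intro!: nsets_3I\<close>)
      then show ?thesis by (intro clique[of "{u, v, d, d', z}"]) (use u d d' z dist 3 in auto)
    qed
  qed
  obtain y where y: "y \<in> V" using fresh[of "{}"] by auto
  obtain C D where CD: "C \<noteq> {}" "D \<noteq> {}" "C \<union> D = V - {y}" "C \<inter> D = {}" "\<forall>a \<in> C. \<forall>b \<in> D. c {y, a, b} = First"
    using cutE[OF y] by metis
  obtain a b where ab: "a \<in> C" "b \<in> D" using CD by blast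
  show ?thesis
  proof (cases "C = {a} \<or> D = {b}")
    case True
    then show ?thesis
    proof
      assume "C = {a}"
      then have "\<forall>w \<in> V - {y, a}. c {y, a, w} = First" using CD ab by blast
      then show ?thesis using star[of y a] y ab CD by blast
    next
      assume D: "D = {b}"
      have "c {y, b, w} = First" if "w \<in> V - {y, b}" for w
      proof -
        have "c {y, w, b} = First" using that D CD by blast
        then show ?thesis by (simp add: insert_commute)
      qed
      then show ?thesis using star[of y b] y ab CD by blast
    qed
  next
    case False
    \<comment> \<open>Both sides have a second vertex: \<open>{y, a}\<close> is hosted with
      \<open>b'\<close>, \<open>{y, b}\<close> with \<open>a'\<close>, and \<open>{a, b}\<close>
      with \<open>y\<close>.\<close>
    then obtain a' b' where ab': "a' \<in> C" "a' \<noteq> a" "b' \<in> D" "b' \<noteq> b" using ab by blast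
    have dist: "a \<noteq> b" "a \<noteq> b'" "a' \<noteq> b" "a' \<noteq> b'" "y \<noteq> a" "y \<noteq> a'" "y \<noteq> b" "y \<noteq> b'"
      using ab ab' CD by blast+
    have col: "c {y, a, b'} = First" "c {y, a', b} = First" "c {y, a, b} = First" using CD ab ab' by blast+
    have "has_clique c First {y, a, b, a', b'} 3"
      by (rule has_clique_3I[of y a b "{y, a, b'}" "{y, a', b}" "{y, a, b}"])
        (use dist col ab' in \<open>auto intro!: nsets_3I\<close>)
    moreover have "{y, a, b, a', b'} \<subseteq> V" using y ab ab' CD by blast
    moreover have "card {y, a, b, a', b'} \<le> 5" by (simp add: card_insert_if)
    ultimately show ?thesis by (intro clique[of "{y, a, b, a', b'}"]) auto
  qed
qed

text \<open>This replaces \<open>arrows_Suc\<close> at \<open>s = 4\<close> and does not refer to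
  \<open>(3, k)\<close>. If some second link is connected, remove its vertex and lower
  \<open>k\<close>. Otherwise all first links are connected, and a first-coloured triangle that
  misses a vertex extends to \<open>K_4\<close>.\<close>

lemma arrows_4_Suc:
  assumes "arrows n 4 k" "n \<ge> 5" "k < n"
  shows "arrows (Suc n) 4 (Suc k)"
  unfolding arrows_def
proof
  fix c :: "nat set \<Rightarrow> colour"
  let ?V = "{..<Suc n}"
  have card: "card (?V - {x}) = n" if "x \<in> ?V" for x using that by simp
  show "has_clique c First ?V 4 \<or> has_clique c Second ?V (Suc k)"
  proof (cases "\<exists>x \<in> ?V. link_connected c Second ?V x")
    case True
    then obtain x where x: "x \<in> ?V" "link_connected c Second ?V x" by blast
    have "has_clique c First (?V - {x}) 4 \<or> has_clique c Second (?V - {x}) k"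
      using arrowsD[OF assms(1) _ card[OF x(1)]] by simp
    then show ?thesis
      using has_clique_Suc[OF _ x, of k] has_clique_mono[of c First "?V - {x}" 4 ?V 4] assms(3) by auto
  next
    case False
    then obtain x where x: "x \<in> ?V" "has_clique c First (?V - {x}) 3"
      using has_clique_3_of_cuts[of ?V c] assms(2) by auto
    then have "link_connected c First ?V x" using False link_connected_cases[of c ?V x] by blast
    then show ?thesis using has_clique_Suc[of ?V x c First 3] x assms(2) by simp
  qed
qed

text \<open>The bound on \<open>s + t\<close> excludes \<open>(4, 4)\<close>, where the formula
  fails by one. The induction starts at \<open>(4, 5)\<close>, climbs the border
  \<open>s = 4\<close> by \<open>arrows_4_Suc\<close>, and uses symmetry for \<open>t = 4\<close>
  and \<open>arrows_Suc\<close> in the interior.\<close>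

lemma arrows_upper:
  assumes "s \<ge> 4" "t \<ge> 4" "s + t \<ge> 9"
  shows "arrows (s + t - 3) s t"
  using assms
proof (induction "s + t" arbitrary: s t rule: less_induct)
  case less
  \<comment> \<open>The induction hypothesis is an explicit premise with fresh \<open>s\<close> and
    \<open>t\<close>, so that the same argument serves with the two exchanged.\<close>
  have four: "arrows (s + t - 3) s t" if st: "s = 4" "t \<ge> 5" "\<And>s' t'. s' + t' < s + t \<Longrightarrow> 4 \<le> s' \<Longrightarrow> 4 \<le> t' \<Longrightarrow> 9 \<le> s' + t' \<Longrightarrow> arrows (s' + t' - 3) s' t'" for s t
  proof (cases "t = 5")
    case True
    then show ?thesis using st arrows_6_4_5 by simp
  next
    case False
    then have "arrows (4 + (t - 1) - 3) 4 (t - 1)" using st(1,2) by (intro st(3)) auto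
    moreover have "4 + (t - 1) - 3 = t" using st(2) by simp
    ultimately have "arrows (Suc t) 4 (Suc (t - 1))" using st(2) by (intro arrows_4_Suc) auto
    then show ?thesis using st by simp
  qed
  consider "s = 4" "t \<ge> 5" | "t = 4" "s \<ge> 5" | "s \<ge> 5" "t \<ge> 5" using less.prems by linarith
  then show ?case
  proof cases
    case 1
    then show ?thesis using four less.hyps by blast
  next
    case 2
    have "arrows (s' + t' - 3) s' t'" if "s' + t' < t + s" "4 \<le> s'" "4 \<le> t'" "9 \<le> s' + t'" for s' t'
      using less.hyps[of s' t'] that by simp
    from four[OF 2 this] have "arrows (t + s - 3) s t" by (rule arrows_commute)
    then show ?thesis by (simp add: add.commute)
  next
    case 3
    define n where "n = s + t - 4"
    have "arrows n (s - 1) (Suc (t - 1))" "arrows n (Suc (s - 1)) (t - 1)"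
      using less.hyps[of "s - 1" t] less.hyps[of s "t - 1"] 3 by (auto simp: n_def)
    then have "arrows (Suc n) (Suc (s - 1)) (Suc (t - 1))"
      using 3 by (intro arrows_Suc) (auto simp: n_def)
    moreover have "Suc n = s + t - 3" "Suc (s - 1) = s" "Suc (t - 1) = t" using 3 by (auto simp: n_def)
    ultimately show ?thesis by simp
  qed
qed

text \<open>The core is to be all of \<open>V\<close>, so no vertex is free to be a root. A triangle
  in the link takes the place of the root: orienting it cyclically gives each of its three vertices
  an edge of its own. The start at five is tight, with ten pairs and ten hyperedges; on four
  vertices there are six pairs but only four hyperedges.\<close>

lemma complete_has_clique:
  fixes V :: "'a set"
  assumes "finite V" "card V \<ge> 5" "\<forall>e \<in> [V]\<^bsup>3\<^esup>. c e = i"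
  shows "has_clique c i V (card V)"
proof -
  have "has_clique c i V n" if "card V = n" "n \<ge> 5" "finite V" "\<forall>e \<in> [V]\<^bsup>3\<^esup>. c e = i" for n and V :: "'a set"
    using that(2,1,3,4)
  proof (induction n arbitrary: V rule: dec_induct)
    case base
    obtain h where "bij_betw h {..<5::nat} V"
      using ex_bij_betw_nat_finite[OF base(2)] base(1) by (auto simp: atLeast0LessThan)
    then have h: "inj_on h {..<5}" "h ` {..<5} = V" by (auto simp: bij_betw_def)
    let ?E = "[{0,1,2},{0,2,4},{0,2,3},{0,1,4},{1,2,3},{0,1,3},{1,3,4},{2,3,4},{1,2,4},{0,3,4}] :: nat set list"
    have "clique_witness ?E [0,1,2,3,4] [2,4,2,1,3,0,3,4,1,0]" by code_simp
    moreover have "\<forall>e \<in> set ?E. c (h ` e) = i"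
    proof
      fix e assume "e \<in> set ?E"
      then have "e \<in> [{..<5}]\<^bsup>3\<^esup>" by (auto simp: nsets_def)
      then have "h ` e \<in> [V]\<^bsup>3\<^esup>" using nsets_image_iff[OF h(1), of e 3] h(2) by (auto simp: nsets_def)
      then show "c (h ` e) = i" using base(3) by blast
    qed
    ultimately have "has_clique (\<lambda>e. c (h ` e)) i (set [0,1,2,3,4] \<union> set [2,4,2,1,3,0,3,4,1,0]) (length [0,1,2,3,4::nat])"
      by (rule clique_witness_has_clique)
    then have "has_clique (\<lambda>e. c (h ` e)) i {..<5} 5"
      by (rule has_clique_mono) auto
    then show ?case using has_clique_image[OF h(1)] h(2) by metis
  next
    case (step n)
    then obtain x where x: "x \<in> V" by fastforce
    have col: "c {x, a, b} = i" if "a \<in> V - {x}" "b \<in> V - {x}" "a \<noteq> b" for a b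
      using step.prems(3) x that by (auto intro!: nsets_3I)
    have "[V - {x}]\<^bsup>3\<^esup> \<subseteq> [V]\<^bsup>3\<^esup>" by (rule nsets_mono) auto
    then have "has_clique c i (V - {x}) n"
      using step x by (intro step.IH) auto
    then obtain A where A: "finite A" "card A = n" "berge_clique c i (V - {x}) A"
      unfolding has_clique_def by blast
    \<comment> \<open>The smaller clique already occupies every vertex other than
      \<open>x\<close>.\<close>
    have "A = V - {x}"
      by (rule card_subset_eq) (use A step.prems x in \<open>auto simp: berge_clique_def\<close>)
    have conn: "link_connected c i V x"
      unfolding link_connected_def
    proof (intro allI impI)
      fix C assume C: "C \<subset> V - {x}" "C \<noteq> {}"
      then obtain a b where "a \<in> C" "b \<in> V - {x} - C" by blast
      moreover from this have "c {x, a, b} = i" using C by (intro col) auto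
      ultimately show "\<exists>a\<in>C. \<exists>b\<in>V - {x} - C. c {x, a, b} = i" by blast
    qed
    have "3 \<le> card (V - {x})" using step x by simp
    then obtain C where "C \<subseteq> V - {x}" "card C = 3" using obtain_subset_with_card_n by metis
    then obtain p q r where pqr: "{p, q, r} \<subseteq> V - {x}" "p \<noteq> q" "p \<noteq> r" "q \<noteq> r"
      by (auto simp: card_3_iff)
    \<comment> \<open>The cyclic orientation of the triangle \<open>p\<close>, \<open>q\<close>,
      \<open>r\<close>, used as the seed for \<open>link_assignment\<close>.\<close>
    define g where "g = (\<lambda>a. if a = p then {p, q} else if a = q then {q, r} else {r, p})"
    have g: "g p = {p, q}" "g q = {q, r}" "g r = {r, p}" using pqr by (auto simp: g_def)
    obtain g' where "inj_on g' A" "\<forall>a \<in> A. a \<in> g' a \<and> g' a \<in> [V - {x}]\<^bsup>2\<^esup> \<and> c (insert x (g' a)) = i"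
    proof -
      have int: "A \<inter> {p, q, r} = {p, q, r}" using \<open>A = V - {x}\<close> pqr by blast
      have "inj_on g (A \<inter> {p, q, r})" unfolding int using pqr(2-) g
        by (auto simp: inj_on_def doubleton_eq_iff)
      moreover have "\<forall>a \<in> A \<inter> {p, q, r}. a \<in> g a \<and> g a \<in> [{p, q, r}]\<^bsup>2\<^esup> \<and> c (insert x (g a)) = i"
        unfolding int using pqr g by (auto simp: nsets_def intro!: col)
      ultimately show ?thesis
        using that link_assignment[OF step.prems(2) conn _ pqr(1), of A g] \<open>A = V - {x}\<close> by blast
    qed
    then have "berge_clique c i V (insert x A)" using berge_clique_insert[OF x A(3)] by blast
    moreover have "x \<notin> A" using \<open>A = V - {x}\<close> by blast
    then have "finite (insert x A)" "card (insert x A) = Suc n" using A(1,2) by simp_all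
    ultimately show ?case unfolding has_clique_def by blast
  qed
  then show ?thesis using assms by blast
qed

section \<open>Upper bounds for s = 2\<close>

lemma has_clique_2I:
  assumes "e \<in> [V]\<^bsup>3\<^esup>" "c e = i"
  shows "has_clique c i V 2"
proof -
  have e: "card e = 3" "finite e" "e \<subseteq> V" using assms(1) by (auto simp: nsets_def)
  then obtain S where S: "S \<subseteq> e" "card S = 2" "finite S"
    using obtain_subset_with_card_n[of 2 e] by auto
  have "p = S" if "p \<in> [S]\<^bsup>2\<^esup>" for p
    using that S by (auto simp: nsets_def card_subset_eq)
  then have "inj_on (\<lambda>_. e) ([S]\<^bsup>2\<^esup>)" "\<forall>p \<in> [S]\<^bsup>2\<^esup>. p \<subseteq> e \<and> e \<in> [V]\<^bsup>3\<^esup> \<and> c e = i"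
    using S assms by (auto simp: inj_on_def)
  then have "berge_clique c i V S" unfolding berge_clique_def using S e by blast
  then show ?thesis unfolding has_clique_def using S by blast
qed

text \<open>A single hyperedge of the first colour is already a Berge \<open>K_2\<close>, so only
  the colouring that is constantly \<open>Second\<close> on the hyperedges has to be
  examined.\<close>

lemma arrows_2I:
  assumes "\<And>c :: nat set \<Rightarrow> colour. \<forall>e \<in> [{..<n}]\<^bsup>3\<^esup>. c e = Second \<Longrightarrow> has_clique c Second {..<n} t"
  shows "arrows n 2 t"
  unfolding arrows_def
proof
  fix c :: "nat set \<Rightarrow> colour"
  show "has_clique c First {..<n} 2 \<or> has_clique c Second {..<n} t"
    using assms[of c] has_clique_2I[of _ "{..<n}" c First] by (metis colour.exhaust)
qed

lemma arrows_2: "t \<ge> 5 \<Longrightarrow> arrows t 2 t"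
  using complete_has_clique[of "{..<t}"] by (intro arrows_2I) simp

lemma arrows_3_2_2: "arrows 3 2 2"
proof (rule arrows_2I)
  fix c :: "nat set \<Rightarrow> colour"
  assume c: "\<forall>e \<in> [{..<3}]\<^bsup>3\<^esup>. c e = Second"
  have "{..<3} \<in> [{..<3::nat}]\<^bsup>3\<^esup>" by (simp add: nsets_def)
  then show "has_clique c Second {..<3} 2" using c has_clique_2I by blast
qed

lemma arrows_4_2_3: "arrows 4 2 3"
proof (rule arrows_2I)
  fix c :: "nat set \<Rightarrow> colour"
  assume c: "\<forall>e \<in> [{..<4}]\<^bsup>3\<^esup>. c e = Second"
  show "has_clique c Second {..<4} 3"
    by (rule has_clique_3I[of 0 1 2 "{0, 1, 3}" "{0, 1, 2}" "{1, 2, 3}"])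
      (use c in \<open>auto intro!: nsets_3I\<close>)
qed

section \<open>Lower bounds\<close>

text \<open>A Berge \<open>K_k\<close> uses as many hyperedges as there are pairs in its core. Give
  each colour fewer than its target demands.\<close>

lemma not_arrows_of_choose:
  assumes "s \<ge> 2" "t \<ge> 2" "n choose 3 \<le> ((s choose 2) - 1) + ((t choose 2) - 1)"
  shows "\<not> arrows n s t"
proof
  assume arr: "arrows n s t"
  have count: "k choose 2 \<le> card {e \<in> [{..<n}]\<^bsup>3\<^esup>. c e = i}" if cl: "has_clique c i {..<n} k" for c i k
  proof -
    obtain S f where S: "finite S" "card S = k" "inj_on f ([S]\<^bsup>2\<^esup>)"
      "\<forall>p \<in> [S]\<^bsup>2\<^esup>. p \<subseteq> f p \<and> f p \<in> [{..<n}]\<^bsup>3\<^esup> \<and> c (f p) = i"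
      using cl unfolding has_clique_def berge_clique_def by blast
    have "card ([S]\<^bsup>2\<^esup>) \<le> card {e \<in> [{..<n}]\<^bsup>3\<^esup>. c e = i}"
      by (rule card_inj_on_le[OF S(3)]) (use S(4) in \<open>auto simp: finite_imp_finite_nsets\<close>)
    then show ?thesis using S by simp
  qed
  have fin: "finite ([{..<n}]\<^bsup>3\<^esup>)" and tot: "card ([{..<n}]\<^bsup>3\<^esup>) = n choose 3"
    by (simp_all add: finite_imp_finite_nsets)
  have pos: "s choose 2 > 0" "t choose 2 > 0" using assms by simp_all
  \<comment> \<open>\<open>X\<close> becomes the first colour class; the minimum covers the case of
    fewer hyperedges than it may receive.\<close>
  obtain X where X: "X \<subseteq> [{..<n}]\<^bsup>3\<^esup>" "card X = min (n choose 3) ((s choose 2) - 1)"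
    using obtain_subset_with_card_n[of "min (n choose 3) ((s choose 2) - 1)" "[{..<n}]\<^bsup>3\<^esup>"] tot by auto
  define c where "c = (\<lambda>e. if e \<in> X then First else Second)"
  have "{e \<in> [{..<n}]\<^bsup>3\<^esup>. c e = First} = X" "{e \<in> [{..<n}]\<^bsup>3\<^esup>. c e = Second} = [{..<n}]\<^bsup>3\<^esup> - X"
    using X(1) by (auto simp: c_def)
  moreover have "card ([{..<n}]\<^bsup>3\<^esup> - X) = (n choose 3) - card X"
    using X(1) fin tot by (metis card_Diff_subset finite_subset)
  moreover have "has_clique c First {..<n} s \<or> has_clique c Second {..<n} t"
    using arr by (simp add: arrows_def)
  ultimately have "s choose 2 \<le> card X \<or> t choose 2 \<le> (n choose 3) - card X"
    using count by metis
  then show False using X(2) assms(3) pos by linarith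
qed

section \<open>Explicit colourings\<close>

lemma card_ge_2E:
  assumes "card A \<ge> 2"
  obtains a b where "a \<in> A" "b \<in> A" "a \<noteq> b"
proof -
  obtain B where "B \<subseteq> A" "card B = 2" using assms obtain_subset_with_card_n by metis
  then show ?thesis using that by (auto simp: card_2_iff)
qed

text \<open>A core of size \<open>s\<close> has two vertices outside \<open>A\<close>, and a core of
  size \<open>t\<close> has two inside \<open>A\<close> because at most \<open>t - 2\<close>
  vertices lie outside. Any host of such a pair has the wrong colour.\<close>

lemma not_arrows_split:
  assumes "s \<ge> 2" "t \<ge> 2" "n \<le> s + t - 4"
  shows "\<not> arrows n s t"
proof
  assume arr: "arrows n s t"
  define A where "A = {..<s - 2}"
  define c where "c = (\<lambda>e. if card (e \<inter> A) \<ge> 2 then First else Second)"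
  have "finite A" "card A = s - 2" by (simp_all add: A_def)
  from arr have "has_clique c First {..<n} s \<or> has_clique c Second {..<n} t" by (simp add: arrows_def)
  then show False
  proof
    assume "has_clique c First {..<n} s"
    then obtain S f where S: "finite S" "card S = s" "\<forall>p \<in> [S]\<^bsup>2\<^esup>. p \<subseteq> f p \<and> f p \<in> [{..<n}]\<^bsup>3\<^esup> \<and> c (f p) = First"
      unfolding has_clique_def berge_clique_def by blast
    have "card (S - A) \<ge> 2"
      using diff_card_le_card_Diff[OF \<open>finite A\<close>, of S] S(2) \<open>card A = s - 2\<close> assms(1) by linarith
    then obtain a b where ab: "a \<in> S - A" "b \<in> S - A" "a \<noteq> b" by (rule card_ge_2E)
    then have "{a, b} \<in> [S]\<^bsup>2\<^esup>" by (auto simp: nsets_def)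
    from bspec[OF S(3) this]
    have f: "{a, b} \<subseteq> f {a, b}" "card (f {a, b}) = 3" "finite (f {a, b})" "c (f {a, b}) = First"
      by (auto simp: nsets_def)
    \<comment> \<open>Two of the three vertices of the host lie outside \<open>A\<close>, which
      leaves at most one inside.\<close>
    have "card (f {a, b} \<inter> A) \<le> card (f {a, b} - {a, b})"
      using f(3) ab by (intro card_mono) auto
    also have "\<dots> = 1" using f ab by (simp add: card_Diff_subset)
    finally show False using f(4) by (simp add: c_def split: if_splits)
  next
    assume "has_clique c Second {..<n} t"
    then obtain S f where S: "finite S" "card S = t" "S \<subseteq> {..<n}"
      "\<forall>p \<in> [S]\<^bsup>2\<^esup>. p \<subseteq> f p \<and> f p \<in> [{..<n}]\<^bsup>3\<^esup> \<and> c (f p) = Second"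
      unfolding has_clique_def berge_clique_def by blast
    have "S - A \<subseteq> {s - 2..<n}" using S(3) by (auto simp: A_def)
    then have "card (S - A) \<le> card {s - 2..<n}" by (intro card_mono) auto
    then have "card (S - A) \<le> t - 2" using assms by simp
    moreover have "card (S \<inter> A) + card (S - A) = card S"
      using card_Un_disjoint[of "S \<inter> A" "S - A"] S(1) by (simp add: Int_Diff_Un Int_Diff_disjoint)
    ultimately have "card (S \<inter> A) \<ge> 2" using S(2) assms(2) by linarith
    then obtain a b where ab: "a \<in> S \<inter> A" "b \<in> S \<inter> A" "a \<noteq> b" by (rule card_ge_2E)
    then have "{a, b} \<in> [S]\<^bsup>2\<^esup>" by (auto simp: nsets_def)
    from bspec[OF S(4) this] have f: "{a, b} \<subseteq> f {a, b}" "c (f {a, b}) = Second" by auto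
    have "card {a, b} \<le> card (f {a, b} \<inter> A)" using f ab \<open>finite A\<close> by (intro card_mono) auto
    then show False using f(2) ab(3) by (simp add: c_def split: if_splits)
  qed
qed

text \<open>Hyperedges through both \<open>0\<close> and \<open>1\<close> get the first colour. A
  core of size \<open>t\<close> contains \<open>0\<close> and \<open>1\<close>, and this pair has no
  second-coloured host. A first-coloured triangle must be \<open>{0, 1, z}\<close>, where two
  different pairs force the same host.\<close>

lemma not_arrows_3:
  assumes "t \<ge> 3"
  shows "\<not> arrows t 3 t"
proof
  assume arr: "arrows t 3 t"
  define c where "c = (\<lambda>e. if {0, 1::nat} \<subseteq> e then First else Second)"
  from arr have "has_clique c First {..<t} 3 \<or> has_clique c Second {..<t} t" by (simp add: arrows_def)
  then show False
  proof
    assume "has_clique c First {..<t} 3"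
    then obtain S f where S: "finite S" "card S = 3" "inj_on f ([S]\<^bsup>2\<^esup>)"
      "\<forall>p \<in> [S]\<^bsup>2\<^esup>. p \<subseteq> f p \<and> f p \<in> [{..<t}]\<^bsup>3\<^esup> \<and> c (f p) = First"
      unfolding has_clique_def berge_clique_def by blast
    have f: "{0, 1, a, b} \<subseteq> f {a, b} \<and> finite (f {a, b}) \<and> card (f {a, b}) = 3 \<and> {a, b} \<in> [S]\<^bsup>2\<^esup>"
      if "a \<in> S" "b \<in> S" "a \<noteq> b" for a b
    proof -
      have *: "{a, b} \<in> [S]\<^bsup>2\<^esup>" using that by (auto simp: nsets_def)
      from bspec[OF S(4) this]
      have "{a, b} \<subseteq> f {a, b}" "f {a, b} \<in> [{..<t}]\<^bsup>3\<^esup>" "{0, 1} \<subseteq> f {a, b}"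
        by (auto simp: c_def split: if_splits)
      then show ?thesis using * by (auto simp: nsets_def)
    qed
    \<comment> \<open>Two core vertices outside \<open>{0, 1}\<close> would give their host four
      vertices.\<close>
    have small: "\<not> (a \<in> S - {0, 1} \<and> b \<in> S - {0, 1} \<and> a \<noteq> b)" for a b
    proof
      assume ab: "a \<in> S - {0, 1} \<and> b \<in> S - {0, 1} \<and> a \<noteq> b"
      then have "card {0, 1, a, b} \<le> card (f {a, b})" using f[of a b] by (intro card_mono) auto
      moreover have "card {0, 1, a, b} = 4" using ab by auto
      ultimately show False using f[of a b] ab by auto
    qed
    have "\<not> card (S - {0, 1}) \<ge> 2" using small by (metis card_ge_2E)
    moreover have "card (S \<inter> {0, 1}) + card (S - {0, 1}) = card S"
      using card_Un_disjoint[of "S \<inter> {0, 1}" "S - {0, 1}"] S(1) by (simp add: Int_Diff_Un Int_Diff_disjoint)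
    ultimately have "card (S \<inter> {0, 1}) \<ge> 2" "card (S - {0, 1}) \<noteq> 0 \<or> card (S \<inter> {0, 1}) = 3"
      using S(2) by linarith+
    moreover have "card (S \<inter> {0, 1}) \<le> card {0, 1::nat}" by (intro card_mono) auto
    moreover have "card {0, 1::nat} = 2" by simp
    ultimately have "S \<inter> {0, 1} = {0, 1}" "card (S - {0, 1}) \<noteq> 0"
      using card_seteq[of "{0, 1::nat}" "S \<inter> {0, 1}"] by auto
    then obtain z where z: "z \<in> S" "z \<noteq> 0" "z \<noteq> 1" by (metis DiffE card.empty ex_in_conv insertCI)
    have "0 \<in> S" "1 \<in> S" using \<open>S \<inter> {0, 1} = {0, 1}\<close> by blast+
    have f0: "{0, 1, 0, z} \<subseteq> f {0, z} \<and> finite (f {0, z}) \<and> card (f {0, z}) = 3 \<and> {0, z} \<in> [S]\<^bsup>2\<^esup>"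
      using z \<open>0 \<in> S\<close> by (intro f) auto
    have f1: "{0, 1, 1, z} \<subseteq> f {1, z} \<and> finite (f {1, z}) \<and> card (f {1, z}) = 3 \<and> {1, z} \<in> [S]\<^bsup>2\<^esup>"
      using z \<open>1 \<in> S\<close> by (intro f) auto
    have card3: "card {0, 1, z} = 3" using z by auto
    \<comment> \<open>Each of these hosts contains \<open>0\<close>, \<open>1\<close> and
      \<open>z\<close> and has three vertices, so both are the same hyperedge.\<close>
    have "{0, 1, z} = f {0, z}" using f0 card3 card_subset_eq[of "f {0, z}" "{0, 1, z}"] by auto
    moreover have "{0, 1, z} = f {1, z}" using f1 card3 card_subset_eq[of "f {1, z}" "{0, 1, z}"] by auto
    ultimately have "{0, z} = {1, z}" using S(3) f0 f1 by (metis inj_onD)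
    then show False using z by (auto simp: doubleton_eq_iff)
  next
    assume "has_clique c Second {..<t} t"
    then obtain S f where S: "card S = t" "S \<subseteq> {..<t}"
      "\<forall>p \<in> [S]\<^bsup>2\<^esup>. p \<subseteq> f p \<and> f p \<in> [{..<t}]\<^bsup>3\<^esup> \<and> c (f p) = Second"
      unfolding has_clique_def berge_clique_def by blast
    have "S = {..<t}" using S(1,2) by (intro card_subset_eq) auto
    then have "{0, 1} \<in> [S]\<^bsup>2\<^esup>" using assms by (auto simp: nsets_def)
    from bspec[OF S(3) this] show False by (auto simp: c_def split: if_splits)
  qed
qed

text \<open>In the constant colouring no hyperedge has the first colour, and there are too few
  vertices for a core of size \<open>t\<close>.\<close>

lemma not_arrows_2:
  assumes "n < t"
  shows "\<not> arrows n 2 t"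
proof
  assume arr: "arrows n 2 t"
  define c where "c = (\<lambda>e :: nat set. Second)"
  from arr have "has_clique c First {..<n} 2 \<or> has_clique c Second {..<n} t" by (simp add: arrows_def)
  then show False
  proof
    assume "has_clique c First {..<n} 2"
    then obtain S f where S: "card S = 2" "finite S"
      "\<forall>p \<in> [S]\<^bsup>2\<^esup>. p \<subseteq> f p \<and> f p \<in> [{..<n}]\<^bsup>3\<^esup> \<and> c (f p) = First"
      unfolding has_clique_def berge_clique_def by blast
    then have "S \<in> [S]\<^bsup>2\<^esup>" by (simp add: nsets_def)
    then show False using S(3) by (auto simp: c_def)
  next
    assume "has_clique c Second {..<n} t"
    then obtain S where "card S = t" "S \<subseteq> {..<n}" unfolding has_clique_def berge_clique_def by blast
    then show False using assms card_mono[of "{..<n}" S] by auto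
  qed
qed

section \<open>The Ramsey numbers\<close>

lemma ramsey_number_eqI:
  assumes "arrows (Suc n) s t" "\<not> arrows n s t"
  shows "ramsey_number 3 (berge_copies 3 (complete_graph s)) (berge_copies 3 (complete_graph t)) = Suc n"
  unfolding ramsey_number_def monochromatic_copy_iff_has_clique arrows_def[symmetric]
proof (rule Least_equality)
  \<comment> \<open>Arrowing is monotone in the number of vertices, so failure at \<open>n\<close>
    excludes every smaller value.\<close>
  fix m assume "arrows m s t"
  then show "Suc n \<le> m" using assms(2) arrows_mono[of m s t n s t] by (meson not_less_eq_eq order_refl)
qed (rule assms(1))

theorem theorem1p5:
  fixes s t :: nat
  assumes "s \<ge> 2" and "t \<ge> 2"
  defines "R \<equiv> ramsey_number 3 (berge_copies 3 (complete_graph s)) (berge_copies 3 (complete_graph t))"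
  shows "(s = 2 \<and> t = 2 \<or> s = 3 \<and> t = 3 \<or> {s, t} = {2, 3} \<or> {s, t} = {2, 4}
            \<longrightarrow> R = t + s - 1) \<and>
         (s = 2 \<and> t \<ge> 5 \<or> t = 2 \<and> s \<ge> 5 \<or> s = 3 \<and> t \<ge> 4 \<or> t = 3 \<and> s \<ge> 4 \<or> s = 4 \<and> t = 4
            \<longrightarrow> R = t + s - 2) \<and>
         (s \<ge> 4 \<and> t \<ge> 5 \<or> t \<ge> 4 \<and> s \<ge> 5
            \<longrightarrow> R = t + s - 3)"
proof -
  have R: "R = N" if "arrows N s t" "\<not> arrows (N - 1) s t" for N
    using ramsey_number_eqI[of "N - 1" s t] that unfolding R_def by (cases N) auto
  \<comment> \<open>Both arrow statements may be proved for the exchanged pair, so each symmetric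
    case reuses the facts of its mirror image.\<close>
  have R': "R = N" if "arrows N t s" "\<not> arrows (N - 1) t s" for N
    using R that arrows_commute by blast
  have small: "R = t + s - 1" if "s = 2 \<and> t = 2 \<or> s = 3 \<and> t = 3 \<or> {s, t} = {2, 3} \<or> {s, t} = {2, 4}"
  proof -
    \<comment> \<open>These two follow from \<open>(3, 4)\<close> and \<open>(2, 5)\<close> on five
      vertices.\<close>
    have five: "arrows 5 3 3" "arrows 5 2 4"
      using arrows_mono[OF arrows_5_3_4] arrows_mono[OF arrows_2[of 5]] by simp_all
    have low: "\<not> arrows 2 2 2" "\<not> arrows 4 3 3" "\<not> arrows 3 2 3" "\<not> arrows 4 2 4"
      by (rule not_arrows_of_choose; simp add: eval_nat_numeral)+
    from that consider "s = 2" "t = 2" | "s = 3" "t = 3" | "s = 2" "t = 3" | "s = 3" "t = 2"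
      | "s = 2" "t = 4" | "s = 4" "t = 2" by (auto simp: doubleton_eq_iff)
    then show ?thesis
    proof cases
      case 1 then show ?thesis using arrows_3_2_2 low by (intro R) auto
    next
      case 2 then show ?thesis using five low by (intro R) auto
    next
      case 3 then show ?thesis using arrows_4_2_3 low by (intro R) auto
    next
      case 4 then show ?thesis using arrows_4_2_3 low by (intro R') auto
    next
      case 5 then show ?thesis using five low by (intro R) auto
    next
      case 6 then show ?thesis using five low by (intro R') auto
    qed
  qed
  have medium: "R = t + s - 2"
    if "s = 2 \<and> t \<ge> 5 \<or> t = 2 \<and> s \<ge> 5 \<or> s = 3 \<and> t \<ge> 4 \<or> t = 3 \<and> s \<ge> 4 \<or> s = 4 \<and> t = 4"
  proof -
    have two: "arrows k 2 k" "\<not> arrows (k - 1) 2 k" if "k \<ge> 5" for k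
      using that arrows_2 not_arrows_2 by auto
    have three: "arrows (Suc k) 3 k" "\<not> arrows k 3 k" if "k \<ge> 4" for k
    proof -
      show "arrows (Suc k) 3 k"
      proof (cases "k = 4")
        case True
        then show ?thesis using arrows_5_3_4 by simp
      next
        case False
        \<comment> \<open>For \<open>k\<close> at least \<open>5\<close>, the bound
          \<open>4 + k - 3\<close> for \<open>(4, k)\<close> is \<open>Suc k\<close> and is
          inherited by \<open>(3, k)\<close>.\<close>
        then show ?thesis using arrows_mono[OF arrows_upper[of 4 k]] that by simp
      qed
      show "\<not> arrows k 3 k" using not_arrows_3 that by simp
    qed
    \<comment> \<open>The upper bound comes from \<open>(4, 5)\<close>. The lower bound splits the
      ten hyperedges on five vertices into five of each colour, one fewer than a Berge
      \<open>K_4\<close> needs.\<close>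
    have four: "arrows 6 4 4" "\<not> arrows 5 4 4"
      using arrows_mono[OF arrows_6_4_5, of 6 4 4] not_arrows_of_choose[of 4 4 5]
      by (simp, simp add: eval_nat_numeral)
    from that consider "s = 2" "t \<ge> 5" | "t = 2" "s \<ge> 5" | "s = 3" "t \<ge> 4" | "t = 3" "s \<ge> 4" | "s = 4" "t = 4"
      by blast
    then show ?thesis
    proof cases
      case 1 then show ?thesis using two[of t] by (intro R) auto
    next
      case 2 then show ?thesis using two[of s] by (intro R') auto
    next
      case 3 then show ?thesis using three[of t] by (intro R) auto
    next
      case 4 then show ?thesis using three[of s] by (intro R') auto
    next
      case 5 then show ?thesis using four by (intro R) auto
    qed
  qed
  have large: "R = t + s - 3" if "s \<ge> 4 \<and> t \<ge> 5 \<or> t \<ge> 4 \<and> s \<ge> 5"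
  proof (rule R)
    show "arrows (t + s - 3) s t" using arrows_upper[of s t] that by (auto simp: add.commute)
    \<comment> \<open>One vertex below the claimed value leaves exactly the \<open>s + t - 4\<close>
      vertices of the split colouring.\<close>
    show "\<not> arrows (t + s - 3 - 1) s t" by (rule not_arrows_split) (use that in auto)
  qed
  from small medium large show ?thesis by blast
qed

end
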